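(* In the setting above, the $\mathcal A$-algebra homomorphism $\phi_v:H_{S/e}\to H_S$ defined by $\phi_v(T'_s)=T_s$ for $s\in S/e\setminus\{s_0\}$ and $\phi_v(T'_{s_0})=T_{s_+}T_{s_-}T_{s_+}^{-1}$ is injective.
   Context: $\mathcal A=\mathbb Z[v,v^{-1}]$. A Coxeter matrix on $S$ is a symmetric matrix $M=(m_{s,s'})$ with entries in $\mathbb Z_{\ge1}\sqcup\{\infty\}$, $m_{s,s'}=1$ iff $s=s'$; $W_{S,M}$ is the associated Coxeter group. A weight function is a map $L_S:S\to\mathbb Z$ with $L_S(s)=L_S(s')$ whenever $s,s'$ are conjugate in $W_{S,M}$; put $v_s=v^{L_S(s)}$. The Hecke algebra $H_S$ is the associative unital $\mathcal A$-algebra generated by $T_s$ ($s\in S$) with relations $(T_s-v_s)(T_s+v_s^{-1})=0$ for all $s$, and $T_sT_{s'}T_s\cdots=T_{s'}T_sT_{s'}\cdots$ (both sides with $m_{s,s'}$ factors) for all $s\ne s'$ with $m_{s,s'}\ne\infty$. Edge contraction: $e=\{s_+,s_-\}\subseteq S$ with $m_{s_+,s_-}=3$; $S/e=(S\setminus\{s_+,s_-\})\sqcup\{s_0\}$; $N=(n_{s,s'})$ with $n_{s,s}=1$, $n_{s,s'}=m_{s,s'}$ for distinct $s,s'\ne s_0$, and for $s\neq s_0$: $n_{s,s_0}=n_{s_0,s}=m_{s,s_+}+m_{s,s_-}-2$ if $m_{s,s_+}=2$ or $m_{s,s_-}=2$ (with $\infty+k=\infty$), and $=\infty$ if both are $>2$.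 The induced weight function is $L_{S/e}(s_0)=L_S(s_+)$ and $L_{S/e}(s)=L_S(s)$ for $s\ne s_0$. $H_{S/e}$ is the Hecke algebra of $(S/e,N,L_{S/e})$, with generators denoted $T'_s$. It is known that $\phi_v$ is a well-defined algebra homomorphism. *)

theory Defs
  imports Main "HOL-Library.Poly_Mapping" "HOL-Library.Extended_Nat"
begin

text \<open>A Laurent polynomial is a finitely supported map from exponents (int) to
  coefficients (int); the convolution product of Poly_Mapping makes this the
  group ring Z[Z] = Z[v,v^-1].\<close>

type_synonym laurent = "int \<Rightarrow>\<^sub>0 int"

definition vpow :: "int \<Rightarrow> laurent" where
  "vpow k = Poly_Mapping.single k 1"

text \<open>Words over the generators, made into a (non-commutative) monoid under
  concatenation; the free A-algebra is then the monoid algebra.\<close>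

datatype 'a fword = Word "'a list"

primrec letters :: "'a fword \<Rightarrow> 'a list" where
  "letters (Word ws) = ws"

instantiation fword :: (type) monoid_add
begin
definition zero_fword :: "'a fword" where "zero_fword = Word []"
definition plus_fword :: "'a fword \<Rightarrow> 'a fword \<Rightarrow> 'a fword" where
  "plus_fword u w = Word (letters u @ letters w)"
instance
proof
  fix a b c :: "'a fword"
  show "a + b + c = a + (b + c)" by (simp add: plus_fword_def)
  show "0 + a = a" by (cases a) (simp add: plus_fword_def zero_fword_def)
  show "a + 0 = a" by (cases a) (simp add: plus_fword_def zero_fword_def)
qed
end

type_synonym 'a falg = "'a fword \<Rightarrow>\<^sub>0 laurent"

definition gen :: "'a \<Rightarrow> 'a falg" where
  "gen s = Poly_Mapping.single (Word [s]) 1"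

definition scal :: "laurent \<Rightarrow> 'a falg" where
  "scal c = Poly_Mapping.single (Word []) c"

definition wordelt :: "'a list \<Rightarrow> 'a falg" where
  "wordelt ws = Poly_Mapping.single (Word ws) 1"

definition in_free :: "'a set \<Rightarrow> 'a falg \<Rightarrow> bool" where
  "in_free X x \<longleftrightarrow> (\<forall>w\<in>Poly_Mapping.keys x. set (letters w) \<subseteq> X)"

inductive_set ideal_gen :: "'r::ring_1 set \<Rightarrow> 'r set" for R where
  base: "r \<in> R \<Longrightarrow> r \<in> ideal_gen R"
| zero: "0 \<in> ideal_gen R"
| add: "a \<in> ideal_gen R \<Longrightarrow> b \<in> ideal_gen R \<Longrightarrow> a + b \<in> ideal_gen R"
| lmult: "a \<in> ideal_gen R \<Longrightarrow> c * a \<in> ideal_gen R"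
| rmult: "a \<in> ideal_gen R \<Longrightarrow> a * c \<in> ideal_gen R"

primrec alt :: "'a \<Rightarrow> 'a \<Rightarrow> nat \<Rightarrow> 'a list" where
  "alt s t 0 = []"
| "alt s t (Suc k) = s # alt t s k"

definition coxeter_matrix :: "'s set \<Rightarrow> ('s \<Rightarrow> 's \<Rightarrow> enat) \<Rightarrow> bool" where
  "coxeter_matrix S m \<longleftrightarrow>
     (\<forall>s\<in>S. \<forall>t\<in>S. m s t = m t s \<and> m s t \<ge> 1 \<and> (m s t = 1 \<longleftrightarrow> s = t))"

text \<open>Equality in the Coxeter group W_{S,M}, given by its presentation
  (generators S, relations s^2 = 1 and the braid relations), on words.\<close>
inductive cox_eq :: "'s set \<Rightarrow> ('s \<Rightarrow> 's \<Rightarrow> enat) \<Rightarrow> 's list \<Rightarrow> 's list \<Rightarrow> bool"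
  for S m where
  refl: "cox_eq S m u u"
| sym: "cox_eq S m u w \<Longrightarrow> cox_eq S m w u"
| trans: "cox_eq S m u w \<Longrightarrow> cox_eq S m w z \<Longrightarrow> cox_eq S m u z"
| ctx: "cox_eq S m u w \<Longrightarrow> cox_eq S m (a @ u @ b) (a @ w @ b)"
| invol: "s \<in> S \<Longrightarrow> cox_eq S m [s, s] []"
| braid: "s \<in> S \<Longrightarrow> t \<in> S \<Longrightarrow> s \<noteq> t \<Longrightarrow> m s t = enat k \<Longrightarrow>
           cox_eq S m (alt s t k) (alt t s k)"

text \<open>s and t conjugate in W: t = w s w^-1 for some w (w^-1 is the reversed word).\<close>
definition cox_conj :: "'s set \<Rightarrow> ('s \<Rightarrow> 's \<Rightarrow> enat) \<Rightarrow> 's \<Rightarrow> 's \<Rightarrow> bool" where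
  "cox_conj S m s t \<longleftrightarrow> (\<exists>w\<in>lists S. cox_eq S m (w @ [s] @ rev w) [t])"

definition weight_function :: "'s set \<Rightarrow> ('s \<Rightarrow> 's \<Rightarrow> enat) \<Rightarrow> ('s \<Rightarrow> int) \<Rightarrow> bool" where
  "weight_function S m L \<longleftrightarrow> (\<forall>s\<in>S. \<forall>t\<in>S. cox_conj S m s t \<longrightarrow> L s = L t)"

definition hecke_rels :: "'s set \<Rightarrow> ('s \<Rightarrow> 's \<Rightarrow> enat) \<Rightarrow> ('s \<Rightarrow> int) \<Rightarrow> 's falg set" where
  "hecke_rels S m L =
     {(gen s - scal (vpow (L s))) * (gen s + scal (vpow (- L s))) | s. s \<in> S}
   \<union> {wordelt (alt s t k) - wordelt (alt t s k) | s t k.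
        s \<in> S \<and> t \<in> S \<and> s \<noteq> t \<and> m s t = enat k}"

text \<open>H_S = (free algebra on S) / hecke_ideal S m L.\<close>
definition hecke_ideal :: "'s set \<Rightarrow> ('s \<Rightarrow> 's \<Rightarrow> enat) \<Rightarrow> ('s \<Rightarrow> int) \<Rightarrow> 's falg set" where
  "hecke_ideal S m L = ideal_gen (hecke_rels S m L)"

text \<open>S/e is modelled inside 's option: None is s_0, Some s is s \<in> S - e.\<close>
definition contract_set :: "'s set \<Rightarrow> 's \<Rightarrow> 's \<Rightarrow> 's option set" where
  "contract_set S sp sm = insert None (Some ` (S - {sp, sm}))"

fun contract_matrix :: "('s \<Rightarrow> 's \<Rightarrow> enat) \<Rightarrow> 's \<Rightarrow> 's \<Rightarrow> 's option \<Rightarrow> 's option \<Rightarrow> enat" where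
  "contract_matrix m sp sm None None = 1"
| "contract_matrix m sp sm (Some s) (Some t) = m s t"
| "contract_matrix m sp sm (Some s) None =
     (if m s sp = 2 \<or> m s sm = 2 then m s sp + m s sm - 2 else \<infinity>)"
| "contract_matrix m sp sm None (Some s) =
     (if m s sp = 2 \<or> m s sm = 2 then m s sp + m s sm - 2 else \<infinity>)"

fun contract_weight :: "('s \<Rightarrow> int) \<Rightarrow> 's \<Rightarrow> 's option \<Rightarrow> int" where
  "contract_weight L sp None = L sp"
| "contract_weight L sp (Some s) = L s"

definition free_hom :: "('a \<Rightarrow> 'b falg) \<Rightarrow> 'a falg \<Rightarrow> 'b falg" where
  "free_hom f x = (\<Sum>w\<in>Poly_Mapping.keys x. scal (Poly_Mapping.lookup x w) * prod_list (map f (letters w)))"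

text \<open>Images of generators: T'_s \<mapsto> T_s, T'_{s0} \<mapsto> T_{s+} T_{s-} y where y
  represents T_{s+}^{-1}.\<close>
fun phi_gen :: "'s \<Rightarrow> 's \<Rightarrow> 's falg \<Rightarrow> 's option \<Rightarrow> 's falg" where
  "phi_gen sp sm y None = gen sp * gen sm * y"
| "phi_gen sp sm y (Some s) = gen s"

end

theory Submission
  imports Defs Complex_Main
begin

text \<open>Put \<open>\<beta> = \<alpha>\<^sub>+ + \<alpha>\<^sub>-\<close> in the geometric representation of \<open>W_S\<close>; its reflection is
  \<open>s\<^sub>+ s\<^sub>- s\<^sub>+\<close>. The vectors \<open>\<beta>\<close> and \<open>\<alpha>_s\<close> (\<open>s \<notin> e\<close>) form a root basis for the contracted Coxeter
  matrix, so the usual positivity of roots makes \<open>W_{S/e}\<close> act faithfully through \<open>W_S\<close>: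
  \<open>\<phi>\<close> is injective at \<open>v = 1\<close>. If \<open>\<Sum> a_w T'_w\<close> lies in the kernel of \<open>\<phi>_v\<close>, let it act on Laurent-valued
  functions on \<open>W_S\<close> (the transposed regular representation of \<open>H_S\<close>); reducing at \<open>v = 1\<close> shows that
  every \<open>a_w\<close> is divisible by \<open>v - 1\<close>, and dividing repeatedly forces all \<open>a_w = 0\<close>.
  Coxeter groups are represented throughout by their reflection groups; presentations are never needed.\<close>

section \<open>Alternating words and Chebyshev polynomials\<close>

text \<open>Replacing s_0 by s_+ s_- s_+ in a reduced word of W_{S/e} need not give a reduced word
  of W_S: for the A_3 diagram s_+ - s_- - s, the reduced word s_0 s s_0 expands to seven letters,
  while its image has length 5. Hence phi(T'_w) has no evident leading term in the standard basis of
  H_S. At v = 1, however, T_s and T_s^{-1} agree and phi(T'_w) becomes a single group element;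
  distinct w give distinct elements, and this starts the descent. Since the elements of W_{S/e} are
  maps by definition, faithfulness has to enter elsewhere: as the statement that one reduced word
  per map spans H_{S/e} modulo its relations. This is Matsumoto's theorem for the contracted root
  basis, and positivity of roots is what proves it. When s is joined to both ends of e, the number 2
  (beta, alpha_s) is only known to be at most -2, so the rank two computations have to cover all
  such values and not just the classical -2.\<close>

lemma set_alt_subset: "set (alt s t k) \<subseteq> {s, t}"
  by (induction k arbitrary: s t) auto

lemma alt_in_lists: "s \<in> I \<Longrightarrow> t \<in> I \<Longrightarrow> alt s t k \<in> lists I"
  using set_alt_subset[of s t k] by (auto simp: in_lists_conv_set)

lemma length_alt [simp]: "length (alt s t k) = k"
  by (induction k arbitrary: s t) auto

lemma alt_Suc_right: "alt s t (Suc k) = alt s t k @ [if even k then s else t]"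
  by (induction k arbitrary: s t) auto

lemma alt_add: "alt s t (k + l) = alt s t k @ (if even k then alt s t l else alt t s l)"
  by (induction k arbitrary: s t) auto

text \<open>Chebyshev polynomials of the second kind, with shifted index: U_{n-1}(c/2). They are the
  coordinates of the roots in a rank two system whose off-diagonal Cartan entry is -c.\<close>

fun cheb :: "real \<Rightarrow> nat \<Rightarrow> real" where
  "cheb c 0 = 0"
| "cheb c (Suc 0) = 1"
| "cheb c (Suc (Suc n)) = c * cheb c (Suc n) - cheb c n"

lemma sin_mult_cheb: "sin a * cheb (2 * cos a) n = sin (real n * a)"
proof (induction "2 * cos a" n rule: cheb.induct)
  case (3 n)
  have "sin a * cheb (2 * cos a) (Suc (Suc n))
      = 2 * cos a * (sin a * cheb (2 * cos a) (Suc n)) - sin a * cheb (2 * cos a) n"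
    by (simp add: algebra_simps)
  also have "\<dots> = 2 * cos a * sin (real n * a + a) - sin (real n * a)"
    using 3 by (simp add: algebra_simps)
  also have "\<dots> = sin (real n * a + a + a)"
  proof -
    have "sin (real n * a) = sin (real n * a + a) * cos a - cos (real n * a + a) * sin a"
      using sin_diff[of "real n * a + a" a] by simp
    then show ?thesis using sin_add[of "real n * a + a" a] by (simp only:) (simp add: algebra_simps)
  qed
  finally show ?case by (simp add: algebra_simps)
qed auto

lemma cheb_cos: "2 \<le> k \<Longrightarrow> cheb (2 * cos (pi / real k)) n = sin (real n * (pi / real k)) / sin (pi / real k)"
proof -
  assume "2 \<le> k"
  then have "sin (pi / real k) > 0"
    by (intro sin_gt_zero) (auto simp: field_simps)
  then show ?thesis using sin_mult_cheb[of "pi / real k" n] by (simp add: field_simps)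
qed

lemma cheb_nonneg_cos:
  assumes "2 \<le> k" "n \<le> k"
  shows "0 \<le> cheb (2 * cos (pi / real k)) n"
proof -
  have "0 \<le> sin (real n * (pi / real k))"
    using assms by (intro sin_ge_zero) (auto simp: field_simps)
  moreover have "0 \<le> sin (pi / real k)"
    using assms by (intro sin_ge_zero) (auto simp: field_simps)
  ultimately show ?thesis using cheb_cos[OF assms(1)] by simp
qed

text \<open>Monotonicity carries the induction: for c at least 2 the increments never
  decrease.\<close>

lemma cheb_nonneg_ge2:
  assumes "2 \<le> c"
  shows "0 \<le> cheb c n \<and> cheb c n \<le> cheb c (Suc n)"
proof (induction n)
  case (Suc n)
  then have "2 * cheb c (Suc n) \<le> c * cheb c (Suc n)"
    using assms by (intro mult_right_mono) auto
  with Suc show ?case by simp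
qed simp

section \<open>Reflection groups with a root basis\<close>

text \<open>A root basis in the sense of Deodhar and Dyer: only the cone \<open>C\<close> and the linear forms
  \<open>f i = 2 (\<delta> i, _)\<close> matter. Off-diagonal entries may be any number \<open>\<le> -2\<close> when \<open>m i j = \<infinity>\<close>;
  this is what lets the reflection subgroup attached to an edge contraction be an instance
  in the same space.\<close>

locale root_basis =
  fixes I :: "'i set" and m :: "'i \<Rightarrow> 'i \<Rightarrow> enat"
    and \<delta> :: "'i \<Rightarrow> 'v::real_vector" and f :: "'i \<Rightarrow> 'v \<Rightarrow> real" and C :: "'v set"
  assumes cox: "coxeter_matrix I m"
    and f_linear: "linear (f i)"
    and f_self: "i \<in> I \<Longrightarrow> f i (\<delta> i) = 2"
    and f_sym: "i \<in> I \<Longrightarrow> j \<in> I \<Longrightarrow> f i (\<delta> j) = f j (\<delta> i)"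
    and f_fin: "i \<in> I \<Longrightarrow> j \<in> I \<Longrightarrow> i \<noteq> j \<Longrightarrow> m i j = enat k \<Longrightarrow> f i (\<delta> j) = - 2 * cos (pi / real k)"
    and f_inf: "i \<in> I \<Longrightarrow> j \<in> I \<Longrightarrow> m i j = \<infinity> \<Longrightarrow> f i (\<delta> j) \<le> - 2"
    and C_add: "x \<in> C \<Longrightarrow> y \<in> C \<Longrightarrow> x + y \<in> C"
    and C_scale: "x \<in> C \<Longrightarrow> 0 \<le> a \<Longrightarrow> a *\<^sub>R x \<in> C"
    and C_pointed: "x \<in> C \<Longrightarrow> - x \<in> C \<Longrightarrow> x = 0"
    and \<delta>_in_C: "i \<in> I \<Longrightarrow> \<delta> i \<in> C"
begin

section \<open>The reflection action and reduced words\<close>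

definition refl :: "'i \<Rightarrow> 'v \<Rightarrow> 'v" where
  "refl i x = x - f i x *\<^sub>R \<delta> i"

text \<open>The first letter of a word acts first.\<close>
primrec act :: "'i list \<Rightarrow> 'v \<Rightarrow> 'v" where
  "act [] = id"
| "act (i # u) = act u \<circ> refl i"

definition reduced :: "'i list \<Rightarrow> bool" where
  "reduced u \<longleftrightarrow> u \<in> lists I \<and> (\<forall>u'\<in>lists I. act u' = act u \<longrightarrow> length u \<le> length u')"

lemma refl_linear: "linear (refl i)"
proof -
  interpret linear "f i" by (rule f_linear)
  show ?thesis unfolding refl_def
    by (rule linearI) (simp_all add: add scale algebra_simps)
qed

lemma act_linear: "linear (act u)"
proof (induction u)
  case Nil
  show ?case unfolding act.simps by (rule linear_id)
next
  case (Cons i u)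
  show ?case unfolding act.simps by (rule linear_compose[OF refl_linear Cons])
qed

lemma refl_self: "i \<in> I \<Longrightarrow> refl i (\<delta> i) = - \<delta> i"
  by (simp add: refl_def f_self scaleR_2)

lemma refl_refl [simp]: "i \<in> I \<Longrightarrow> refl i (refl i x) = x"
proof -
  assume "i \<in> I"
  interpret linear "f i" by (rule f_linear)
  show ?thesis using f_self[OF \<open>i \<in> I\<close>] by (simp add: refl_def diff scale algebra_simps)
qed

lemma act_append: "act (u @ w) = act w \<circ> act u"
  by (induction u) auto

lemma act_rev: "u \<in> lists I \<Longrightarrow> act (rev u) \<circ> act u = id"
proof (induction u)
  case (Cons i u)
  then have "act (rev u) (act u x) = x" for x by (metis comp_apply id_apply lists.cases list.inject Cons_in_lists_iff)
  with Cons.prems show ?case by (auto simp: act_append fun_eq_iff)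
qed simp

lemma act_inverse: "u \<in> lists I \<Longrightarrow> act (rev u) (act u x) = x"
  using act_rev by (metis comp_apply id_apply)

lemma act_eq_0: "u \<in> lists I \<Longrightarrow> act u x = 0 \<Longrightarrow> x = 0"
  using act_inverse[of u x] linear_0[OF act_linear] by metis

lemma act_neg: "act u (- x) = - act u x"
  using linear_neg[OF act_linear] .

lemma act_Cons_self: "i \<in> I \<Longrightarrow> act (i # u) (\<delta> i) = - act u (\<delta> i)"
  by (simp add: refl_self act_neg)

lemma act_Cons_Cons_same: "i \<in> I \<Longrightarrow> act (i # i # u) = act u"
  by (auto simp: fun_eq_iff)

lemma act_Cons_cancel: "i \<in> I \<Longrightarrow> act (i # u) = act (i # w) \<Longrightarrow> act u = act w"
  by (metis act_Cons_Cons_same act.simps(2))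

lemma \<delta>_nonzero: "i \<in> I \<Longrightarrow> \<delta> i \<noteq> 0"
  using f_self[of i] linear_0[OF f_linear, of i] by fastforce

lemma not_both_signs:
  assumes "u \<in> lists I" "i \<in> I" "act u (\<delta> i) \<in> C" "- act u (\<delta> i) \<in> C"
  shows False
  using C_pointed[OF assms(3,4)] act_eq_0[OF assms(1)] \<delta>_nonzero[OF assms(2)] by blast

lemma exists_reduced:
  assumes "u \<in> lists I"
  obtains u' where "reduced u'" "act u' = act u" "length u' \<le> length u"
proof -
  define P where "P w \<longleftrightarrow> w \<in> lists I \<and> act w = act u" for w
  have "P u" using assms by (simp add: P_def)
  then have "P (arg_min length P)" "\<And>w. P w \<Longrightarrow> length (arg_min length P) \<le> length w"
    by (auto intro: arg_min_natI arg_min_nat_le)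
  with \<open>P u\<close> show thesis
    by (intro that[of "arg_min length P"]) (auto simp: reduced_def P_def)
qed

lemma reduced_in_lists: "reduced u \<Longrightarrow> u \<in> lists I"
  by (simp add: reduced_def)

lemma reduced_le: "reduced u \<Longrightarrow> w \<in> lists I \<Longrightarrow> act w = act u \<Longrightarrow> length u \<le> length w"
  by (simp add: reduced_def)

lemma reduced_same_length: "reduced u \<Longrightarrow> reduced w \<Longrightarrow> act u = act w \<Longrightarrow> length u = length w"
  by (metis reduced_def order_antisym)

lemma reduced_appendD:
  assumes "reduced (a @ b)"
  shows "reduced a" "reduced b"
proof -
  have ab: "a \<in> lists I" "b \<in> lists I" using assms by (auto simp: reduced_def)
  have "length a \<le> length w" if "w \<in> lists I" "act w = act a" for w
    using reduced_le[OF assms, of "w @ b"] that ab by (simp add: act_append)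
  moreover have "length b \<le> length w" if "w \<in> lists I" "act w = act b" for w
    using reduced_le[OF assms, of "a @ w"] that ab by (simp add: act_append)
  ultimately show "reduced a" "reduced b" using ab by (auto simp: reduced_def)
qed

lemma reduced_ConsD: "reduced (i # u) \<Longrightarrow> reduced u"
  using reduced_appendD(2)[of "[i]" u] by simp

section \<open>Rank two: dihedral subgroups and their roots\<close>

abbreviation c :: "'i \<Rightarrow> 'i \<Rightarrow> real" where "c i j \<equiv> - f i (\<delta> j)"

lemma m_ge2: "i \<in> I \<Longrightarrow> j \<in> I \<Longrightarrow> i \<noteq> j \<Longrightarrow> m i j = enat k \<Longrightarrow> 2 \<le> k"
  using cox unfolding coxeter_matrix_def
  by (metis One_nat_def Suc_1 enat_1 enat_ord_simps(1) le_neq_implies_less not_less_eq_eq nat_less_le not_less)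

lemma m_sym: "i \<in> I \<Longrightarrow> j \<in> I \<Longrightarrow> m i j = m j i"
  using cox unfolding coxeter_matrix_def by blast

lemma c_sym: "i \<in> I \<Longrightarrow> j \<in> I \<Longrightarrow> c i j = c j i"
  using f_sym by simp

lemma cheb_nonneg:
  assumes "s \<in> I" "t \<in> I" "s \<noteq> t" "enat k \<le> m s t"
  shows "0 \<le> cheb (c s t) k"
proof (cases "m s t")
  case (enat n)
  then show ?thesis using cheb_nonneg_cos[of n k] m_ge2 f_fin assms by simp
next
  case infinity
  then show ?thesis using cheb_nonneg_ge2[of "c s t" k] f_inf[of s t] assms by simp
qed

lemma refl_comb:
  assumes "s \<in> I" "t \<in> I"
  shows "refl t (a *\<^sub>R \<delta> s + b *\<^sub>R \<delta> t) = a *\<^sub>R \<delta> s + (c s t * a - b) *\<^sub>R \<delta> t"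
proof -
  interpret linear "f t" by (rule f_linear)
  show ?thesis using f_self[OF assms(2)] f_sym[OF assms]
    by (simp add: refl_def add scale algebra_simps flip: scaleR_2)
qed

text \<open>By \<open>refl_comb\<close> each reflection performs one step of the Chebyshev recursion
  on the pair of coordinates. The free starting index \<open>j\<close> is what the induction
  needs.\<close>

lemma act_alt_cheb:
  assumes "s \<in> I" "t \<in> I"
  shows "act (alt t s k) (cheb (c s t) (Suc j) *\<^sub>R \<delta> s + cheb (c s t) j *\<^sub>R \<delta> t)
    = (if even k then cheb (c s t) (Suc (j + k)) *\<^sub>R \<delta> s + cheb (c s t) (j + k) *\<^sub>R \<delta> t
       else cheb (c s t) (j + k) *\<^sub>R \<delta> s + cheb (c s t) (Suc (j + k)) *\<^sub>R \<delta> t)"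
  using assms
proof (induction k arbitrary: j s t)
  case (Suc k)
  have "refl t (cheb (c s t) (Suc j) *\<^sub>R \<delta> s + cheb (c s t) j *\<^sub>R \<delta> t)
      = cheb (c t s) (Suc (Suc j)) *\<^sub>R \<delta> t + cheb (c t s) (Suc j) *\<^sub>R \<delta> s"
    using refl_comb[OF Suc.prems] c_sym[OF Suc.prems] by simp
  then show ?case
    using Suc.IH[of t s "Suc j"] Suc.prems c_sym[OF Suc.prems] by (simp add: add.commute)
qed simp

lemma act_alt_root:
  assumes "s \<in> I" "t \<in> I"
  shows "act (alt t s k) (\<delta> s)
    = (if even k then cheb (c s t) (Suc k) *\<^sub>R \<delta> s + cheb (c s t) k *\<^sub>R \<delta> t
       else cheb (c s t) k *\<^sub>R \<delta> s + cheb (c s t) (Suc k) *\<^sub>R \<delta> t)"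
  using act_alt_cheb[OF assms, of k 0] by simp

text \<open>At angle pi/k the Chebyshev values with indices k - 1, k, k + 1 are 1, 0, -1, so both
  words of length k send the root to minus the same simple root.\<close>

lemma act_alt_braid_root:
  assumes "s \<in> I" "t \<in> I" "s \<noteq> t" "m s t = enat k"
  shows "act (alt s t k) (\<delta> s) = act (alt t s k) (\<delta> s)"
proof -
  have k2: "2 \<le> k" using m_ge2 assms by blast
  then obtain l where l: "k = Suc l" by (cases k) auto
  have sg: "sin (pi / real k) > 0"
    using k2 by (intro sin_gt_zero) (auto simp: field_simps)
  have cst: "c s t = 2 * cos (pi / real k)" using f_fin[OF assms] by simp
  have 1: "cheb (c s t) k = 0" using cheb_cos[OF k2, of k] k2 unfolding cst by simp
  have "sin (real l * (pi / real k)) = sin (pi - pi / real k)"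
    using l by (intro arg_cong[of _ _ sin]) (simp add: field_simps)
  then have 2: "cheb (c s t) l = 1" using cheb_cos[OF k2, of l] sg unfolding cst by simp
  have 3: "cheb (c s t) (Suc k) = - 1" using 1 2 l by simp
  have "act (alt s t k) (\<delta> s) = - act (alt t s l) (\<delta> s)"
    using l assms(1) by (simp add: refl_self act_neg)
  then show ?thesis
    unfolding act_alt_root[OF assms(1,2)] using 1 2 3 l by auto
qed

lemma act_alt_fixed:
  assumes "f s x = 0" "f t x = 0"
  shows "act (alt s t k) x = x"
  using assms by (induction k arbitrary: s t) (auto simp: refl_def)

text \<open>For finite \<open>m s t\<close> the Gram matrix of the two roots is nonsingular. Hence
  every vector is a combination of them plus a vector fixed by both reflections, and only the two
  roots have to be checked.\<close>

lemma act_alt_braid: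
  assumes "s \<in> I" "t \<in> I" "s \<noteq> t" "m s t = enat k"
  shows "act (alt s t k) = act (alt t s k)"
proof
  fix x
  have k2: "2 \<le> k" using m_ge2 assms by blast
  have sg: "sin (pi / real k) > 0"
    using k2 by (intro sin_gt_zero) (auto simp: field_simps)
  define d where "d = cos (pi / real k)"
  have fst: "f s (\<delta> t) = - 2 * d" "f t (\<delta> s) = - 2 * d"
    using f_fin[OF assms] f_sym assms by (auto simp: d_def)
  have det: "4 - 4 * d\<^sup>2 \<noteq> 0"
    using sg sin_cos_squared_add[of "pi / real k"] unfolding d_def by (auto simp: power2_eq_square)
  \<comment> \<open>Cramer's rule for the coefficients that make \<open>f s\<close> and
    \<open>f t\<close> vanish on the remainder \<open>y\<close>.\<close>
  define a where "a = (2 * f s x + 2 * d * f t x) / (4 - 4 * d\<^sup>2)"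
  define b where "b = (2 * f t x + 2 * d * f s x) / (4 - 4 * d\<^sup>2)"
  define y where "y = x - a *\<^sub>R \<delta> s - b *\<^sub>R \<delta> t"
  have "2 * a - 2 * d * b = f s x" "2 * b - 2 * d * a = f t x"
    using det unfolding a_def b_def by (simp_all add: divide_simps) (simp_all add: power2_eq_square algebra_simps)
  then have y: "f s y = 0" "f t y = 0"
    using f_self[OF assms(1)] f_self[OF assms(2)] fst unfolding y_def linear_diff[OF f_linear] linear_scale[OF f_linear]
    by (simp_all add: mult.commute mult.left_commute)
  have x: "x = y + a *\<^sub>R \<delta> s + b *\<^sub>R \<delta> t" by (simp add: y_def)
  have "m t s = enat k" using assms m_sym by metis
  then have "act (alt s t k) (\<delta> t) = act (alt t s k) (\<delta> t)"
    using act_alt_braid_root[of t s k] assms by simp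
  moreover have "act (alt s t k) y = act (alt t s k) y"
    using act_alt_fixed y by metis
  ultimately show "act (alt s t k) x = act (alt t s k) x"
    unfolding x linear_add[OF act_linear] linear_scale[OF act_linear] act_alt_braid_root[OF assms]
    by (simp only:)
qed

lemma alternating_if_reduced:
  assumes "reduced d" "set d \<subseteq> {s, t}"
  shows "d = alt s t (length d) \<or> d = alt t s (length d)"
  using assms
proof (induction d)
  case (Cons i d)
  have i: "i \<in> I" "d \<in> lists I" using Cons.prems by (auto simp: reduced_def)
  have "i = s \<or> i = t" using Cons.prems by simp
  have IH: "d = alt s t (length d) \<or> d = alt t s (length d)"
    using Cons reduced_ConsD by simp
  show ?case
  proof (cases d)
    case Nil
    then show ?thesis using \<open>i = s \<or> i = t\<close> by auto
  next
    case (Cons j d')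
    have "i \<noteq> j"
    proof
      assume "i = j"
      then have "act d' = act (i # d)" using act_Cons_Cons_same i Cons by metis
      then show False using reduced_le[OF Cons.prems(1), of d'] i Cons by simp
    qed
    then show ?thesis using IH \<open>i = s \<or> i = t\<close> Cons by auto
  qed
qed simp

text \<open>With n = \<open>m s t\<close>, braiding the last n letters of an alternating word of n +
  1 letters makes its first two letters equal; n - 1 letters remain after cancelling them.\<close>

lemma reduced_alt_le:
  assumes "s \<in> I" "t \<in> I" "s \<noteq> t" "reduced (alt s t k)"
  shows "enat k \<le> m s t"
proof (cases "m s t")
  case (enat n)
  have "k \<le> n"
  proof (rule ccontr)
    assume "\<not> k \<le> n"
    then obtain l where k: "k = Suc n + l" by (metis not_less_eq_eq nat_le_iff_add)
    have "reduced (alt s t (Suc n))"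
      using assms(4) unfolding k alt_add by (rule reduced_appendD)
    obtain n' where n: "n = Suc n'" using m_ge2[OF assms(1-3) enat] by (cases n) auto
    have "act (alt s t (Suc n)) = act (s # alt s t n)"
      using act_alt_braid[OF assms(1-3) enat] by simp
    also have "\<dots> = act (alt t s n')"
      unfolding n alt.simps by (rule act_Cons_Cons_same[OF assms(1)])
    finally have "act (alt t s n') = act (alt s t (Suc n))" by (rule HOL.sym)
    from reduced_le[OF \<open>reduced (alt s t (Suc n))\<close> alt_in_lists[OF assms(2,1)] this]
    show False using n by simp
  qed
  then show ?thesis using enat by simp
qed simp

text \<open>Among the length-additive factorizations of \<open>u\<close> through the dihedral
  subgroup, \<open>x\<close> is a shortest second factor. A shorter word \<open>w\<close> for
  \<open>r # x\<close> would give the factorization \<open>(d @ [r]) @ w\<close>, which is again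
  additive because \<open>u\<close> is reduced, against the choice of \<open>x\<close>.\<close>

lemma dihedral_decomposition:
  assumes u: "reduced u" and st: "s \<in> I" "t \<in> I" "s \<noteq> t"
  obtains d k x where "d = alt s t k \<or> d = alt t s k" "enat k \<le> m s t" "reduced x"
    "act (d @ x) = act u" "length u = k + length x"
    "\<And>r w. r \<in> {s, t} \<Longrightarrow> w \<in> lists I \<Longrightarrow> act w = act (r # x) \<Longrightarrow> length x \<le> length w"
proof -
  define P where "P x \<longleftrightarrow> (\<exists>d\<in>lists {s, t}. x \<in> lists I \<and> act (d @ x) = act u \<and> length u = length d + length x)" for x
  define x where "x = arg_min length P"
  have "P u" using reduced_in_lists[OF u] unfolding P_def by (intro bexI[of _ "[]"]) auto
  then have Px: "P x" and min: "\<And>w. P w \<Longrightarrow> length x \<le> length w"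
    unfolding x_def by (auto intro: arg_min_natI arg_min_nat_le)
  obtain d where d: "d \<in> lists {s, t}" "x \<in> lists I" "act (d @ x) = act u" "length u = length d + length x"
    using Px by (auto simp: P_def)
  have "{s, t} \<subseteq> I" using st by simp
  then have dI: "d \<in> lists I" using d(1) lists_mono by blast
  have dx: "reduced (d @ x)"
    using u d dI unfolding reduced_def by auto
  have "d = alt s t (length d) \<or> d = alt t s (length d)"
    using alternating_if_reduced[of d s t] reduced_appendD[OF dx] d(1) by (auto simp: in_lists_conv_set)
  moreover from this have "enat (length d) \<le> m s t"
    using reduced_alt_le[of s t "length d"] reduced_alt_le[of t s "length d"] st m_sym
      reduced_appendD(1)[OF dx] by metis
  moreover have "length x \<le> length w"
    if r: "r \<in> {s, t}" and w: "w \<in> lists I" "act w = act (r # x)" for r w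
  proof (rule ccontr)
    assume less: "\<not> length x \<le> length w"
    have rI: "r \<in> I" using r st by auto
    have "act (r # w) = act x"
      using w act_Cons_Cons_same[OF rI] by simp
    then have a: "act ((d @ [r]) @ w) = act u" using d by (simp add: act_append)
    then have "length u \<le> length ((d @ [r]) @ w)"
      using reduced_le[OF u, of "(d @ [r]) @ w"] dI rI w by simp
    then have "P w"
      unfolding P_def using a d w less r by (intro bexI[of _ "d @ [r]"]) auto
    then show False using min less by blast
  qed
  ultimately show thesis
    using that[of d "length d" x] reduced_appendD(2)[OF dx] d by blast
qed

section \<open>Positivity of roots and descents\<close>

lemma comb_in_C:
  assumes "act x (\<delta> s) \<in> C" "act x (\<delta> t) \<in> C" "0 \<le> a" "0 \<le> b"
  shows "act x (a *\<^sub>R \<delta> s + b *\<^sub>R \<delta> t) \<in> C"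
  using assms C_add C_scale by (simp add: linear_add[OF act_linear] linear_scale[OF act_linear])

text \<open>The root has Chebyshev coordinates of indices k and k + 1; the strict bound on k keeps
  both within the range where they are nonnegative.\<close>

lemma act_alt_root_in_C:
  assumes st: "s \<in> I" "t \<in> I" "s \<noteq> t" and k: "enat k < m s t"
    and x: "act x (\<delta> s) \<in> C" "act x (\<delta> t) \<in> C"
  shows "act (alt t s k @ x) (\<delta> s) \<in> C"
proof -
  have "enat (Suc k) \<le> m s t" "enat k \<le> m s t" using k by (auto simp: Suc_ile_eq)
  then have "0 \<le> cheb (c s t) k" "0 \<le> cheb (c s t) (Suc k)"
    using cheb_nonneg[OF st] by auto
  then show ?thesis
    using comb_in_C[OF x] by (auto simp: act_append act_alt_root[OF st(1,2)])
qed

text \<open>The last hypothesis says that prefixing \<open>s\<close> does not shorten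
  \<open>u\<close>. Split off the dihedral part of \<open>u\<close> for \<open>s\<close> and the
  first letter \<open>t\<close>: the remaining factor is shorter and sends both simple roots into
  the cone, and the dihedral part turns the root of \<open>s\<close> into a nonnegative combination
  of the two.\<close>

theorem root_positive:
  assumes "reduced u" "s \<in> I" "\<And>w. w \<in> lists I \<Longrightarrow> act w = act (s # u) \<Longrightarrow> length u \<le> length w"
  shows "act u (\<delta> s) \<in> C"
  using assms
proof (induction "length u" arbitrary: u s rule: less_induct)
  case less
  show ?case
  proof (cases u)
    case Nil
    then show ?thesis using \<delta>_in_C less.prems by simp
  next
    case (Cons t u')
    have u: "u \<in> lists I" using less.prems reduced_in_lists by blast
    have t: "t \<in> I" "u' \<in> lists I" using u Cons by auto
    have "s \<noteq> t"
    proof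
      assume "s = t"
      then have "act u' = act (s # u)" using act_Cons_Cons_same t Cons by metis
      then show False using less.prems(3)[of u'] t Cons by simp
    qed
    then obtain d k x where d: "d = alt s t k \<or> d = alt t s k" "enat k \<le> m s t" "reduced x"
      "act (d @ x) = act u" "length u = k + length x"
      and min: "\<And>r w. r \<in> {s, t} \<Longrightarrow> w \<in> lists I \<Longrightarrow> act w = act (r # x) \<Longrightarrow> length x \<le> length w"
      using dihedral_decomposition[OF less.prems(1,2) t(1)] by metis
    have x: "x \<in> lists I" using d reduced_in_lists by blast
    \<comment> \<open>A leading \<open>s\<close> in \<open>d\<close> would cancel and leave a word
      for \<open>s # u\<close> shorter than \<open>u\<close>.\<close>
    have no_s: False if "d = s # d'" for d'
    proof -
      have "d \<in> lists I" using d(1) alt_in_lists less.prems(2) t(1) by metis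
      then have d': "d' \<in> lists I" using that by simp
      have "act (d' @ x) = act (s # u)"
      proof -
        have "act (s # u) = act (d @ x) \<circ> refl s" using d(4) by simp
        also have "\<dots> = act (s # s # (d' @ x))" using that by (simp only: append.simps act.simps)
        finally show ?thesis using act_Cons_Cons_same[OF less.prems(2)] by metis
      qed
      moreover have "length d = k" using d(1) by auto
      ultimately show False using less.prems(3)[of "d' @ x"] d' x that d(5) by simp
    qed
    have k0: "0 < k"
    proof (rule ccontr)
      assume "\<not> 0 < k"
      then have "d = []" "length u = length x" using d by auto
      then have "act u' = act (t # x)"
        using d(4) Cons act_Cons_Cons_same[OF t(1)] by simp
      then show False using min[of t u'] t Cons \<open>length u = length x\<close> by simp
    qed
    then have dt: "d = alt t s k"
      using d(1) no_s by (cases k) auto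
    \<comment> \<open>At k = \<open>m s t\<close> the braid relation rewrites \<open>d\<close> to
      begin with \<open>s\<close>, and the same cancellation shortens \<open>s # u\<close>.\<close>
    have "enat k \<noteq> m s t"
    proof
      assume k: "enat k = m s t"
      have eq: "act (alt s t k) = act (alt t s k)"
        using act_alt_braid[OF less.prems(2) t(1) \<open>s \<noteq> t\<close>] k by simp
      obtain l where l: "k = Suc l" using k0 by (cases k) auto
      have "act (s # u) = act (s # alt s t k @ x)"
        using d(4) eq unfolding dt by (simp add: act_append)
      also have "\<dots> = act (alt t s l @ x)"
        unfolding l alt.simps append.simps by (rule act_Cons_Cons_same[OF less.prems(2)])
      finally show False
        using less.prems(3)[of "alt t s l @ x"] x d(5) l alt_in_lists[of t I s l] less.prems(2) t by simp
    qed
    then have "enat k < m s t" using d(2) by simp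
    moreover have "act x (\<delta> s) \<in> C" "act x (\<delta> t) \<in> C"
      using less.hyps[of x s] less.hyps[of x t] d k0 min less.prems(2) t by auto
    ultimately show ?thesis
      using act_alt_root_in_C[OF less.prems(2) t(1) \<open>s \<noteq> t\<close>, of k x] d(4) dt by simp
  qed
qed

lemma root_negative:
  assumes "u \<in> lists I" "s \<in> I" "w \<in> lists I" "act w = act (s # u)" "length w < length u" "reduced u"
  shows "- act u (\<delta> s) \<in> C"
proof -
  obtain w' where w': "reduced w'" "act w' = act w" "length w' \<le> length w"
    using exists_reduced[OF assms(3)] by blast
  have sw: "act (s # w') = act u"
    using w' assms(2,4) act_Cons_Cons_same by simp
  have "act w' (\<delta> s) \<in> C"
  proof (rule root_positive[OF w'(1) assms(2)])
    fix v assume "v \<in> lists I" "act v = act (s # w')"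
    then show "length w' \<le> length v" using sw reduced_le[OF assms(6)] w' assms(5) by fastforce
  qed
  moreover have "act u (\<delta> s) = - act w' (\<delta> s)"
    using sw act_Cons_self[OF assms(2)] by metis
  ultimately show ?thesis by simp
qed

text \<open>The lengths of \<open>u\<close> and of a reduced word for \<open>s # u\<close> cannot
  agree: then neither would be shortened by prefixing \<open>s\<close>, so the root and its negative
  would both be positive. This sign argument takes the place of the parity given by a
  determinant.\<close>

lemma not_reduced_Cons:
  assumes "reduced u" "s \<in> I" "\<not> reduced (s # u)"
  obtains w where "reduced w" "act w = act (s # u)" "length u = Suc (length w)"
proof -
  have u: "u \<in> lists I" using assms reduced_in_lists by blast
  obtain w where w: "reduced w" "act w = act (s # u)" "length w \<le> length (s # u)"
    using exists_reduced[of "s # u"] u assms by auto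
  have wI: "w \<in> lists I" using w reduced_in_lists by blast
  have sw: "act (s # w) = act u" using w(2) act_Cons_Cons_same[OF assms(2)] by simp
  have "length w \<noteq> length (s # u)"
    using assms w u unfolding reduced_def by (metis Cons_in_lists_iff)
  moreover have "length w \<noteq> length u"
  proof
    assume eq: "length w = length u"
    have "act u (\<delta> s) \<in> C"
      by (rule root_positive[OF assms(1,2)]) (use w eq reduced_le in metis)
    moreover have "act w (\<delta> s) \<in> C"
      by (rule root_positive[OF w(1) assms(2)]) (use assms(1) sw eq reduced_le in metis)
    moreover have "act w (\<delta> s) = - act u (\<delta> s)"
      using w(2) act_Cons_self[OF assms(2)] by metis
    ultimately show False using not_both_signs[OF u assms(2)] by simp
  qed
  moreover have "length u \<le> Suc (length w)"
    using reduced_le[OF assms(1), of "s # w"] sw wI assms(2) by simp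
  ultimately show thesis using that[of w] w by simp
qed

lemma sign_dichotomy:
  assumes "u \<in> lists I" "s \<in> I"
  shows "act u (\<delta> s) \<in> C \<or> - act u (\<delta> s) \<in> C"
proof -
  obtain w where w: "reduced w" "act w = act u"
    using exists_reduced[OF assms(1)] by blast
  then show ?thesis
    using root_positive[OF w(1) assms(2)] root_negative[OF reduced_in_lists[OF w(1)] assms(2) _ _ _ w(1)]
    by (metis not_le)
qed

section \<open>Matsumoto's theorem\<close>

inductive braid_eq :: "'i list \<Rightarrow> 'i list \<Rightarrow> bool" where
  braid_refl: "braid_eq u u"
| braid_trans: "braid_eq u w \<Longrightarrow> braid_eq w z \<Longrightarrow> braid_eq u z"
| braid_Cons: "braid_eq u w \<Longrightarrow> braid_eq (i # u) (i # w)"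
| braid_move: "i \<in> I \<Longrightarrow> j \<in> I \<Longrightarrow> i \<noteq> j \<Longrightarrow> m i j = enat k \<Longrightarrow> braid_eq (alt i j k @ x) (alt j i k @ x)"

text \<open>If the first letters \<open>s\<close> and \<open>t\<close> differ, both are descents of
  the common element, so its dihedral part is the longest one. The element then has a reduced word
  beginning with each of \<open>alt s t k\<close> and \<open>alt t s k\<close>; these differ by one
  braid move, and the induction hypothesis joins them to \<open>u\<close> and \<open>w\<close> after
  removal of the common first letter.\<close>

theorem matsumoto:
  assumes "reduced u" "reduced w" "act u = act w"
  shows "braid_eq u w"
  using assms
proof (induction "length u" arbitrary: u w rule: less_induct)
  case less
  have len: "length u = length w" using less.prems reduced_same_length by blast
  show ?case
  proof (cases u)
    case Nil
    then show ?thesis using len braid_refl by simp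
  next
    case (Cons s u')
    then obtain t w' where w: "w = t # w'" using len by (cases w) auto
    have I: "s \<in> I" "t \<in> I" "u' \<in> lists I" "w' \<in> lists I"
      using reduced_in_lists[OF less.prems(1)] reduced_in_lists[OF less.prems(2)] w Cons by auto
    have red: "reduced u'" "reduced w'" using less.prems reduced_ConsD w Cons by auto
    have len': "length u' < length u" "length w' < length u" using w Cons len by auto
    show ?thesis
    proof (cases "s = t")
      case True
      then have "act u' = act w'" using less.prems w Cons act_Cons_cancel I by metis
      then show ?thesis using less.hyps[of u' w'] red len' w Cons True braid_Cons by simp
    next
      case False
      have u: "u \<in> lists I" using less.prems reduced_in_lists by blast
      have neg: "- act u (\<delta> s) \<in> C" "- act u (\<delta> t) \<in> C"
        using root_negative[OF u I(1) I(3)] root_negative[OF u I(2) I(4)] less.prems w Cons len' I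
          act_Cons_Cons_same by (metis act.simps(2))+
      obtain d k x where d: "d = alt s t k \<or> d = alt t s k" "enat k \<le> m s t" "reduced x"
        "act (d @ x) = act u" "length u = k + length x"
        and min: "\<And>r w. r \<in> {s, t} \<Longrightarrow> w \<in> lists I \<Longrightarrow> act w = act (r # x) \<Longrightarrow> length x \<le> length w"
        using dihedral_decomposition[OF less.prems(1) I(1,2) False] by metis
      have x: "x \<in> lists I" using d reduced_in_lists by blast
      have xC: "act x (\<delta> s) \<in> C" "act x (\<delta> t) \<in> C"
        using root_positive[OF d(3)] I min by auto
      \<comment> \<open>If \<open>d\<close> were not longest, the letter with which the other
        alternating word begins would have a positive root at \<open>u\<close>, but both roots are
        negative.\<close>
      have k: "enat k = m s t"
      proof (rule ccontr)
        assume "enat k \<noteq> m s t"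
        then have "enat k < m s t" "enat k < m t s" using d(2) m_sym I by auto
        then have "act u (\<delta> s) \<in> C \<or> act u (\<delta> t) \<in> C"
          using d(1,4) act_alt_root_in_C[of s t k x] act_alt_root_in_C[of t s k x] xC I False by metis
        then show False using neg not_both_signs u I by blast
      qed
      then have k': "m s t = enat k" "m t s = enat k" using m_sym I by auto
      obtain l where l: "k = Suc l" using m_ge2[OF I(1,2) False k'(1)] by (cases k) auto
      have eq: "act (alt s t k) = act (alt t s k)" using act_alt_braid I False k' by simp
      have u1: "act (s # alt t s l @ x) = act u" and w1: "act (t # alt s t l @ x) = act u"
        using d(1,4) eq l by (auto simp: act_append comp_assoc)
      have lists: "alt s t l @ x \<in> lists I" "alt t s l @ x \<in> lists I"
        using alt_in_lists[OF I(1,2), of l] alt_in_lists[OF I(2,1), of l] x by simp_all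
      have r: "reduced (s # alt t s l @ x)" "reduced (t # alt s t l @ x)"
        using less.prems(1) u1 w1 lists I d(5) l unfolding reduced_def by auto
      have "act u' = act (alt t s l @ x)"
        using u1 Cons act_Cons_cancel[OF I(1)] by metis
      then have 1: "braid_eq u (s # alt t s l @ x)"
        using less.hyps[of u' "alt t s l @ x"] reduced_ConsD r red len' Cons braid_Cons by blast
      have "act (alt s t l @ x) = act w'"
        using w1 w less.prems(3) act_Cons_cancel[OF I(2)] by metis
      then have 2: "braid_eq (t # alt s t l @ x) w"
        using less.hyps[of "alt s t l @ x" w'] reduced_ConsD r red len' d(5) l w braid_Cons by simp
      have "braid_eq (s # alt t s l @ x) (t # alt s t l @ x)"
        using braid_move[OF I(1,2) False k'(1), of x] l by simp
      then show ?thesis using 1 2 braid_trans by blast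
    qed
  qed
qed

end

section \<open>Congruence modulo a two-sided ideal\<close>

definition ideal_cong :: "'r::ring_1 set \<Rightarrow> 'r \<Rightarrow> 'r \<Rightarrow> bool" where
  "ideal_cong R x y \<longleftrightarrow> x - y \<in> ideal_gen R"

lemma ideal_gen_neg: "x \<in> ideal_gen R \<Longrightarrow> - x \<in> ideal_gen R"
  using ideal_gen.lmult[of x R "- 1"] by simp

lemma ideal_gen_diff: "x \<in> ideal_gen R \<Longrightarrow> y \<in> ideal_gen R \<Longrightarrow> x - y \<in> ideal_gen R"
  using ideal_gen.add[of x R "- y"] ideal_gen_neg[of y R] by simp

lemma ideal_cong_refl [simp]: "ideal_cong R x x"
  by (simp add: ideal_cong_def ideal_gen.zero)

lemma ideal_cong_sym: "ideal_cong R x y \<Longrightarrow> ideal_cong R y x"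
  unfolding ideal_cong_def using ideal_gen_neg[of "x - y" R] by simp

lemma ideal_cong_trans [trans]: "ideal_cong R x y \<Longrightarrow> ideal_cong R y z \<Longrightarrow> ideal_cong R x z"
  unfolding ideal_cong_def using ideal_gen.add[of "x - y" R "y - z"] by simp

lemma ideal_cong_add: "ideal_cong R x x' \<Longrightarrow> ideal_cong R y y' \<Longrightarrow> ideal_cong R (x + y) (x' + y')"
  unfolding ideal_cong_def using ideal_gen.add[of "x - x'" R "y - y'"] by (simp add: algebra_simps)

lemma ideal_cong_diff: "ideal_cong R x x' \<Longrightarrow> ideal_cong R y y' \<Longrightarrow> ideal_cong R (x - y) (x' - y')"
  unfolding ideal_cong_def using ideal_gen_diff[of "x - x'" R "y - y'"] by (simp add: algebra_simps)

lemma ideal_cong_mult: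
  assumes "ideal_cong R x x'" "ideal_cong R y y'"
  shows "ideal_cong R (x * y) (x' * y')"
proof -
  have "x * y - x' * y' = (x - x') * y + x' * (y - y')" by (simp add: algebra_simps)
  then show ?thesis
    using assms ideal_gen.add ideal_gen.lmult ideal_gen.rmult unfolding ideal_cong_def by metis
qed

lemmas ideal_cong_lmult = ideal_cong_mult[OF ideal_cong_refl]
lemmas ideal_cong_rmult = ideal_cong_mult[OF _ ideal_cong_refl]

section \<open>The free algebra\<close>

lemma poly_mapping_sum_single:
  "x = (\<Sum>k\<in>Poly_Mapping.keys x. Poly_Mapping.single k (Poly_Mapping.lookup x k))"
  by (rule poly_mapping_eqI) (auto simp: lookup_sum lookup_single when_def in_keys_iff)

lemma zero_fword_Word: "(0 :: 'a fword) = Word []"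
  by (simp add: zero_fword_def)

lemma wordelt_Nil [simp]: "wordelt [] = 1"
  by (simp add: wordelt_def flip: zero_fword_Word)

lemma wordelt_append: "wordelt (u @ w) = wordelt u * wordelt w"
  by (simp add: wordelt_def mult_single plus_fword_def)

lemma wordelt_single: "wordelt [s] = gen s"
  by (simp add: wordelt_def gen_def)

lemma wordelt_Cons: "wordelt (s # u) = gen s * wordelt u"
  using wordelt_append[of "[s]" u] by (simp add: wordelt_single)

lemma single_Word: "Poly_Mapping.single (Word u) a = scal a * wordelt u"
  by (simp add: scal_def wordelt_def mult_single plus_fword_def)

lemma scal_0 [simp]: "scal 0 = 0"
  and scal_1 [simp]: "scal 1 = 1"
  and scal_add: "scal (a + b) = scal a + scal b"
  and scal_diff: "scal (a - b) = scal a - scal b"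
  and scal_mult: "scal (a * b) = scal a * scal b"
  by (simp_all add: scal_def single_add single_diff mult_single flip: zero_fword_Word)

lemma falg_eq_sum: "x = (\<Sum>w\<in>Poly_Mapping.keys x. scal (Poly_Mapping.lookup x w) * wordelt (letters w))"
proof -
  have "Poly_Mapping.single w a = scal a * wordelt (letters w)" for w :: "'a fword" and a
    by (cases w) (simp add: single_Word)
  then show ?thesis using poly_mapping_sum_single[of x] by simp
qed

lemma falg_induct [case_names add word]:
  assumes add: "\<And>x y. P x \<Longrightarrow> P y \<Longrightarrow> P (x + y)"
    and word: "\<And>a u. P (scal a * wordelt u)"
  shows "P x"
proof -
  have "P (\<Sum>w\<in>K. scal (Poly_Mapping.lookup x w) * wordelt (letters w))" if "finite K" for K
    using that
  proof induction
    case empty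
    show ?case using word[of 0 "[]"] by simp
  qed (use add word in auto)
  then show ?thesis using falg_eq_sum[of x] by (metis finite_keys)
qed

lemma scal_commute: "scal a * x = x * scal a"
proof (induction x rule: falg_induct)
  case (word b u)
  have "scal a * wordelt u = wordelt u * scal a"
    by (simp add: scal_def wordelt_def mult_single plus_fword_def)
  then have "scal b * wordelt u * scal a = scal (b * a) * wordelt u"
    by (simp only: mult.assoc scal_mult flip: \<open>scal a * wordelt u = wordelt u * scal a\<close>)
  moreover have "scal a * (scal b * wordelt u) = scal (a * b) * wordelt u"
    by (simp only: mult.assoc scal_mult)
  ultimately show ?case by (simp only: mult.commute[of a b])
qed (simp add: algebra_simps)

lemma scal_mult_mult: "scal a * x * (scal b * y) = scal (a * b) * (x * y)"
proof -
  have "scal a * x * (scal b * y) = scal a * (x * scal b) * y" by (simp only: mult.assoc)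
  also have "\<dots> = scal a * (scal b * x) * y" by (simp only: scal_commute[of b x])
  finally show ?thesis by (simp only: mult.assoc scal_mult)
qed

lemma free_hom_add: "free_hom g (x + y) = free_hom g x + free_hom g y"
  unfolding free_hom_def by (rule setsum_keys_plus_distrib) (simp_all add: scal_add algebra_simps)

lemma free_hom_term: "free_hom g (scal a * wordelt u) = scal a * prod_list (map g u)"
  by (cases "a = 0") (simp_all add: free_hom_def flip: single_Word)

lemma free_hom_wordelt: "free_hom g (wordelt u) = prod_list (map g u)"
  using free_hom_term[of g 1 u] by simp

lemma free_hom_scal: "free_hom g (scal a) = scal a"
  using free_hom_term[of g a "[]"] by simp

lemma free_hom_gen: "free_hom g (gen s) = g s"
  using free_hom_wordelt[of g "[s]"] by (simp add: wordelt_single)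

lemma free_hom_0: "free_hom g 0 = 0"
  by (simp add: free_hom_def)

lemma free_hom_diff: "free_hom g (x - y) = free_hom g x - free_hom g y"
  using free_hom_add[of g "x - y" y] by simp

lemma free_hom_mult: "free_hom g (x * y) = free_hom g x * free_hom g y"
proof (induction x rule: falg_induct)
  case (word a u)
  show ?case
  proof (induction y rule: falg_induct)
    case (word b w)
    show ?case
      by (simp add: scal_mult_mult free_hom_term flip: wordelt_append)
  qed (simp add: algebra_simps free_hom_add)
qed (simp add: algebra_simps free_hom_add)

lemma free_hom_sum: "free_hom g (sum h K) = (\<Sum>k\<in>K. free_hom g (h k))"
  by (induction K rule: infinite_finite_induct) (simp_all add: free_hom_0 free_hom_add)

lemma free_hom_ideal_gen:
  assumes "x \<in> ideal_gen R" "\<And>r. r \<in> R \<Longrightarrow> free_hom g r \<in> ideal_gen R'"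
  shows "free_hom g x \<in> ideal_gen R'"
  using assms(1)
  by induction (auto simp: free_hom_0 free_hom_add free_hom_mult assms(2) intro: ideal_gen.intros)

section \<open>Laurent polynomials\<close>

definition eval1 :: "laurent \<Rightarrow> int" where
  "eval1 a = (\<Sum>k\<in>Poly_Mapping.keys a. Poly_Mapping.lookup a k)"

lemma eval1_0 [simp]: "eval1 0 = 0"
  by (simp add: eval1_def)

lemma eval1_add: "eval1 (a + b) = eval1 a + eval1 b"
  unfolding eval1_def by (rule setsum_keys_plus_distrib) simp_all

lemma eval1_diff: "eval1 (a - b) = eval1 a - eval1 b"
  using eval1_add[of "a - b" b] by simp

lemma eval1_sum: "eval1 (sum g K) = (\<Sum>k\<in>K. eval1 (g k))"
  by (induction K rule: infinite_finite_induct) (simp_all add: eval1_add)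

lemma eval1_single [simp]: "eval1 (Poly_Mapping.single k n) = n"
  by (cases "n = 0") (simp_all add: eval1_def)

lemma eval1_vpow [simp]: "eval1 (vpow k) = 1"
  by (simp add: vpow_def)

lemma eval1_1 [simp]: "eval1 1 = 1"
  using eval1_single[of 0 1] by (simp del: eval1_single)

lemma eval1_mult: "eval1 (a * b) = eval1 a * eval1 b"
proof -
  have "eval1 (Poly_Mapping.single k n * b) = n * eval1 b" for k n
    by (subst (1 2) poly_mapping_sum_single[of b])
      (simp add: sum_distrib_left mult_single eval1_sum)
  then show ?thesis
    by (subst (1 2) poly_mapping_sum_single[of a])
      (simp add: sum_distrib_right eval1_sum)
qed

lemma vpow_0 [simp]: "vpow 0 = 1"
  by (simp add: vpow_def)

lemma vpow_mult: "vpow j * vpow k = vpow (j + k)"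
  by (simp add: vpow_def mult_single)

lemma vpow_1_neq_1: "vpow 1 \<noteq> 1"
proof
  assume "vpow 1 = 1"
  moreover have "Poly_Mapping.lookup (vpow 1) 1 = 1" by (simp add: vpow_def)
  moreover have "Poly_Mapping.lookup (1 :: laurent) 1 = 0" by (simp add: lookup_one)
  ultimately show False by simp
qed

text \<open>Division by v - 1 with control of the support: the quotient lies in an interval that is
  shorter by one exponent. This width is the measure of the later descent.\<close>

lemma eval1_eq_0_imp_divisible:
  assumes "Poly_Mapping.keys a \<subseteq> {l..l + int n}" "eval1 a = 0"
  obtains b where "Poly_Mapping.keys b \<subseteq> {l..<l + int n}" "a = (vpow 1 - 1) * b"
  using assms
proof (induction n arbitrary: a thesis)
  case 0
  then have "Poly_Mapping.keys a \<subseteq> {l}" by auto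
  then have "a = Poly_Mapping.single l (Poly_Mapping.lookup a l)"
    by (auto intro!: poly_mapping_eqI simp: lookup_single when_def in_keys_iff)
  then have "a = 0" using 0 eval1_single single_zero by metis
  then show ?case using 0(1)[of 0] by simp
next
  case (Suc n)
  define k where "k = l + int n"
  \<comment> \<open>Subtracting (v - 1) \<open>d\<close> moves the coefficient at the top exponent k
    + 1 down to exponent k and keeps the value at v = 1.\<close>
  define d where "d = Poly_Mapping.single k (Poly_Mapping.lookup a (k + 1))"
  define a' where "a' = a - (vpow 1 - 1) * d"
  have vd: "(vpow 1 - 1) * d = Poly_Mapping.single (k + 1) (Poly_Mapping.lookup a (k + 1)) - d"
    by (simp add: d_def vpow_def algebra_simps mult_single)
  have a': "a' = a - Poly_Mapping.single (k + 1) (Poly_Mapping.lookup a (k + 1)) + d"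
    unfolding a'_def vd by simp
  have "Poly_Mapping.keys a' \<subseteq> {l..l + int n}"
  proof
    fix i assume "i \<in> Poly_Mapping.keys a'"
    then have i: "Poly_Mapping.lookup a' i \<noteq> 0" by (simp add: in_keys_iff)
    then have "i \<noteq> k + 1" by (auto simp: a' lookup_add lookup_minus lookup_single d_def)
    moreover have "i = k \<or> Poly_Mapping.lookup a i \<noteq> 0"
      using i \<open>i \<noteq> k + 1\<close> by (auto simp: a' lookup_add lookup_minus lookup_single d_def when_def split: if_splits)
    then have "i = k \<or> i \<in> {l..l + int (Suc n)}" using Suc.prems(2) by (auto simp: in_keys_iff)
    ultimately show "i \<in> {l..l + int n}" by (auto simp: k_def)
  qed
  moreover have "eval1 a' = 0"
    by (simp add: a'_def eval1_diff eval1_mult Suc.prems)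
  ultimately obtain b where b: "Poly_Mapping.keys b \<subseteq> {l..<l + int n}" "a' = (vpow 1 - 1) * b"
    using Suc.IH[of a'] by metis
  have "Poly_Mapping.keys (b + d) \<subseteq> {l..<l + int (Suc n)}"
  proof
    fix i assume "i \<in> Poly_Mapping.keys (b + d)"
    then have "i \<in> Poly_Mapping.keys b \<or> i = k"
      using Poly_Mapping.keys_add[of b d] by (auto simp: d_def split: if_splits)
    then show "i \<in> {l..<l + int (Suc n)}" using b(1) by (auto simp: k_def)
  qed
  moreover have "a = (vpow 1 - 1) * (b + d)"
    using b(2) by (simp add: a'_def algebra_simps)
  ultimately show ?case using Suc.prems(1) by blast
qed

text \<open>Infinite descent on the width of the exponent range: reducing at \<open>v = 1\<close> shows that
  all the coefficients are divisible by \<open>v - 1\<close>.\<close>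
lemma zero_if_identity_at_1:
  assumes "finite F"
    and K: "\<And>i j. i \<in> F \<Longrightarrow> j \<in> F \<Longrightarrow> eval1 (K i j) = (if i = j then 1 else 0)"
    and eq: "\<And>j. j \<in> F \<Longrightarrow> (\<Sum>i\<in>F. a i * K i j) = 0"
    and i: "i \<in> F"
  shows "a i = 0"
proof -
  have "finite (\<Union>i\<in>F. Poly_Mapping.keys (a i))" using assms(1) by simp
  then obtain l u where lu: "(\<Union>i\<in>F. Poly_Mapping.keys (a i)) \<subseteq> {l..u}"
    by (meson bdd_above_finite bdd_below_finite bdd_above.E bdd_below.E atLeastAtMost_iff subsetI)
  have "\<forall>i\<in>F. a i = 0"
    if "\<And>i. i \<in> F \<Longrightarrow> Poly_Mapping.keys (a i) \<subseteq> {l..<l + int n}"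
      "\<And>j. j \<in> F \<Longrightarrow> (\<Sum>i\<in>F. a i * K i j) = 0" for n a
    using that
  proof (induction n arbitrary: a)
    case 0
    then show ?case by simp
  next
    case (Suc n)
    have "\<exists>b. Poly_Mapping.keys b \<subseteq> {l..<l + int n} \<and> a j = (vpow 1 - 1) * b" if j: "j \<in> F" for j
    proof -
      have "0 = (\<Sum>i\<in>F. eval1 (a i) * eval1 (K i j))"
        using arg_cong[OF Suc.prems(2)[OF j], of eval1] by (simp add: eval1_sum eval1_mult)
      also have "\<dots> = (\<Sum>i\<in>F. if i = j then eval1 (a i) else 0)"
        by (rule sum.cong) (auto simp: K j)
      also have "\<dots> = eval1 (a j)" using assms(1) j by simp
      finally have "eval1 (a j) = 0" by simp
      moreover have "Poly_Mapping.keys (a j) \<subseteq> {l..l + int n}"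
        using Suc.prems(1)[OF j] by auto
      ultimately show ?thesis by (metis eval1_eq_0_imp_divisible)
    qed
    then obtain b where b: "\<And>j. j \<in> F \<Longrightarrow> Poly_Mapping.keys (b j) \<subseteq> {l..<l + int n}"
      "\<And>j. j \<in> F \<Longrightarrow> a j = (vpow 1 - 1) * b j" by metis
    have "(\<Sum>i\<in>F. b i * K i j) = 0" if j: "j \<in> F" for j
    proof -
      have "(vpow 1 - 1) * (\<Sum>i\<in>F. b i * K i j) = (\<Sum>i\<in>F. a i * K i j)"
        unfolding sum_distrib_left by (rule sum.cong) (simp_all add: b mult.assoc)
      moreover have "vpow 1 - 1 \<noteq> 0" using vpow_1_neq_1 by simp
      ultimately show ?thesis using Suc.prems(2)[OF j] by simp
    qed
    then have "\<forall>i\<in>F. b i = 0" using Suc.IH[of b] b(1) by blast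
    then show ?case using b(2) by simp
  qed
  moreover have "Poly_Mapping.keys (a i) \<subseteq> {l..<l + int (nat (u - l + 1))}" if "i \<in> F" for i
    using lu that by fastforce
  ultimately show ?thesis using eq i by blast
qed

section \<open>Hecke algebras\<close>

lemma hecke_quadratic:
  "(x - scal (vpow k)) * (x + scal (vpow (- k))) = x * x - (scal (vpow k - vpow (- k)) * x + 1)"
proof -
  have "scal (vpow k) * scal (vpow (- k)) = 1"
    by (simp add: vpow_mult flip: scal_mult)
  then show ?thesis
    using scal_commute[of "vpow (- k)" x] by (simp add: algebra_simps scal_diff)
qed

lemma hecke_quadratic_cong:
  assumes "s \<in> S"
  shows "ideal_cong (hecke_rels S m L) (gen s * gen s) (scal (vpow (L s) - vpow (- L s)) * gen s + 1)"
  unfolding ideal_cong_def hecke_quadratic[symmetric]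
  using assms by (intro ideal_gen.base) (auto simp: hecke_rels_def)

lemma hecke_braid_cong:
  assumes "s \<in> S" "t \<in> S" "s \<noteq> t" "m s t = enat k"
  shows "ideal_cong (hecke_rels S m L) (wordelt (alt s t k)) (wordelt (alt t s k))"
  using assms unfolding ideal_cong_def
  by (intro ideal_gen.base) (unfold hecke_rels_def, blast)

section \<open>Operators on functions and their extension to the free algebra\<close>

definition rep :: "('i \<Rightarrow> ('w \<Rightarrow> laurent) \<Rightarrow> 'w \<Rightarrow> laurent) \<Rightarrow> 'i falg \<Rightarrow> ('w \<Rightarrow> laurent) \<Rightarrow> 'w \<Rightarrow> laurent" where
  "rep T x h w = (\<Sum>u\<in>Poly_Mapping.keys x. Poly_Mapping.lookup x u * foldr T (letters u) h w)"

lemma rep_add: "rep T (x + y) h w = rep T x h w + rep T y h w"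
  unfolding rep_def by (rule setsum_keys_plus_distrib) (simp_all add: algebra_simps)

lemma rep_0: "rep T 0 h w = 0"
  by (simp add: rep_def)

lemma rep_diff: "rep T (x - y) h w = rep T x h w - rep T y h w"
  using rep_add[of T "x - y" y h w] by simp

lemma rep_sum: "rep T (sum g K) h w = (\<Sum>k\<in>K. rep T (g k) h w)"
  by (induction K rule: infinite_finite_induct) (simp_all add: rep_0 rep_add)

lemma rep_term: "rep T (scal a * wordelt u) h w = a * foldr T u h w"
  by (cases "a = 0") (simp_all add: rep_def flip: single_Word)

lemma rep_wordelt: "rep T (wordelt u) h w = foldr T u h w"
  using rep_term[of T 1 u h w] by simp

lemma rep_gen: "rep T (gen s) h w = T s h w"
  using rep_wordelt[of T "[s]" h w] by (simp add: wordelt_single)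

lemma rep_1: "rep T 1 h w = h w"
  using rep_wordelt[of T "[]" h w] by simp

context
  fixes T :: "'i \<Rightarrow> ('w \<Rightarrow> laurent) \<Rightarrow> 'w \<Rightarrow> laurent"
  assumes T_add: "\<And>i h g. T i (\<lambda>w. h w + g w) = (\<lambda>w. T i h w + T i g w)"
    and T_scale: "\<And>i a h. T i (\<lambda>w. a * h w) = (\<lambda>w. a * T i h w)"
begin

lemma foldr_T_add: "foldr T u (\<lambda>w. h w + g w) = (\<lambda>w. foldr T u h w + foldr T u g w)"
  by (induction u) (simp_all add: T_add)

lemma foldr_T_scale: "foldr T u (\<lambda>w. a * h w) = (\<lambda>w. a * foldr T u h w)"
  by (induction u) (simp_all add: T_scale)

lemma rep_mult: "rep T (x * y) h = rep T x (rep T y h)"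
proof
  fix w
  show "rep T (x * y) h w = rep T x (rep T y h) w"
  proof (induction x rule: falg_induct)
    case (word a u)
    show ?case
    proof (induction y rule: falg_induct)
      case (add y z)
      have "rep T (y + z) h = (\<lambda>w. rep T y h w + rep T z h w)"
        by (rule ext) (rule rep_add)
      with add show ?case
        by (simp add: distrib_left rep_add rep_term foldr_T_add)
    next
      case (word b z)
      have "rep T (scal b * wordelt z) h = (\<lambda>w. b * foldr T z h w)"
        by (rule ext) (rule rep_term)
      moreover have "scal a * wordelt u * (scal b * wordelt z) = scal (a * b) * wordelt (u @ z)"
        by (simp only: scal_mult_mult wordelt_append)
      ultimately show ?case
        by (simp only: rep_term foldr_T_scale foldr_append comp_apply mult.assoc)
    qed
  qed (simp add: distrib_right rep_add)
qed

end

context root_basis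
begin

subsection \<open>Words of reduced expressions span\<close>

definition elements :: "('v \<Rightarrow> 'v) set" where
  "elements = act ` lists I"

text \<open>By \<open>matsumoto\<close> any two choices give congruent elements of the free algebra,
  so this word stands for the standard basis element T_w.\<close>

definition red_word :: "('v \<Rightarrow> 'v) \<Rightarrow> 'i list" where
  "red_word w = (SOME u. reduced u \<and> act u = w)"

lemma red_word:
  assumes "w \<in> elements"
  shows "reduced (red_word w)" "act (red_word w) = w"
proof -
  have "\<exists>u. reduced u \<and> act u = w"
    using assms exists_reduced unfolding elements_def by (metis imageE)
  then have "reduced (red_word w) \<and> act (red_word w) = w"
    unfolding red_word_def by (rule someI_ex)
  then show "reduced (red_word w)" "act (red_word w) = w" by auto
qed

definition red_comb :: "(('v \<Rightarrow> 'v) \<Rightarrow>\<^sub>0 laurent) \<Rightarrow> 'i falg" where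
  "red_comb a = (\<Sum>w\<in>Poly_Mapping.keys a. scal (Poly_Mapping.lookup a w) * wordelt (red_word w))"

lemma red_comb_add: "red_comb (a + b) = red_comb a + red_comb b"
  unfolding red_comb_def by (rule setsum_keys_plus_distrib) (simp_all add: scal_add algebra_simps)

lemma red_comb_single: "red_comb (Poly_Mapping.single w a) = scal a * wordelt (red_word w)"
  by (cases "a = 0") (simp_all add: red_comb_def)

lemma braid_eq_cong:
  "braid_eq u w \<Longrightarrow> ideal_cong (hecke_rels I m L) (wordelt u) (wordelt w)"
proof (induction rule: braid_eq.induct)
  case (braid_Cons u w i)
  from braid_Cons.IH show ?case unfolding wordelt_Cons by (rule ideal_cong_lmult)
next
  case (braid_move i j k x)
  then show ?case unfolding wordelt_append by (intro ideal_cong_rmult hecke_braid_cong)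
qed (auto intro: ideal_cong_trans)

definition red_span :: "('i \<Rightarrow> int) \<Rightarrow> 'i falg set" where
  "red_span L = {x. \<exists>a. Poly_Mapping.keys a \<subseteq> elements \<and> ideal_cong (hecke_rels I m L) x (red_comb a)}"

lemma red_span_add:
  assumes "x \<in> red_span L" "y \<in> red_span L"
  shows "x + y \<in> red_span L"
proof -
  obtain a b where "Poly_Mapping.keys a \<subseteq> elements" "ideal_cong (hecke_rels I m L) x (red_comb a)"
    "Poly_Mapping.keys b \<subseteq> elements" "ideal_cong (hecke_rels I m L) y (red_comb b)"
    using assms unfolding red_span_def by blast
  moreover have "Poly_Mapping.keys (a + b) \<subseteq> Poly_Mapping.keys a \<union> Poly_Mapping.keys b"
    by (rule Poly_Mapping.keys_add)
  ultimately show ?thesis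
    unfolding red_span_def
    by (auto intro!: exI[of _ "a + b"] ideal_cong_add simp: red_comb_add)
qed

lemma red_span_0: "0 \<in> red_span L"
  unfolding red_span_def by (auto intro!: exI[of _ 0] simp: red_comb_def)

lemma red_span_sum: "(\<And>k. k \<in> K \<Longrightarrow> g k \<in> red_span L) \<Longrightarrow> sum g K \<in> red_span L"
  by (induction K rule: infinite_finite_induct) (auto intro: red_span_add red_span_0)

lemma red_span_cong: "ideal_cong (hecke_rels I m L) x y \<Longrightarrow> y \<in> red_span L \<Longrightarrow> x \<in> red_span L"
  unfolding red_span_def using ideal_cong_trans by blast

lemma red_span_reduced:
  assumes "reduced u"
  shows "scal a * wordelt u \<in> red_span L"
proof -
  have w: "act u \<in> elements" using reduced_in_lists[OF assms] by (simp add: elements_def)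
  have "ideal_cong (hecke_rels I m L) (wordelt u) (wordelt (red_word (act u)))"
    using matsumoto[OF assms red_word(1)[OF w]] red_word(2)[OF w] by (intro braid_eq_cong) simp
  then have "ideal_cong (hecke_rels I m L) (scal a * wordelt u) (red_comb (Poly_Mapping.single (act u) a))"
    unfolding red_comb_single by (rule ideal_cong_lmult)
  moreover have "Poly_Mapping.keys (Poly_Mapping.single (act u) a) \<subseteq> elements"
    using w by simp
  ultimately show ?thesis unfolding red_span_def by blast
qed

text \<open>If \<open>i # u\<close> is not reduced, \<open>matsumoto\<close> lets \<open>u\<close>
  begin with \<open>i\<close>, and the quadratic relation turns the resulting square into terms on
  reduced words.\<close>

lemma red_span_gen_reduced:
  assumes u: "reduced u" and i: "i \<in> I"
  shows "scal a * (gen i * wordelt u) \<in> red_span L"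
proof (cases "reduced (i # u)")
  case True
  then show ?thesis using red_span_reduced[OF True] by (simp add: wordelt_Cons)
next
  case False
  let ?R = "hecke_rels I m L"
  obtain w where w: "reduced w" "act w = act (i # u)" "length u = Suc (length w)"
    using not_reduced_Cons[OF u i False] by blast
  have iw: "act (i # w) = act u" using w(2) act_Cons_Cons_same[OF i] by simp
  have red: "reduced (i # w)"
    using u reduced_in_lists[OF w(1)] i iw w(3) unfolding reduced_def by simp
  define xi where "xi = vpow (L i) - vpow (- L i)"
  have "ideal_cong ?R (wordelt u) (gen i * wordelt w)"
    using braid_eq_cong[OF matsumoto[OF u red iw[symmetric]]] by (simp add: wordelt_Cons)
  then have "ideal_cong ?R (gen i * wordelt u) (gen i * gen i * wordelt w)"
    unfolding mult.assoc by (rule ideal_cong_lmult)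
  also have "ideal_cong ?R (gen i * gen i * wordelt w) ((scal xi * gen i + 1) * wordelt w)"
    unfolding xi_def by (intro ideal_cong_rmult hecke_quadratic_cong i)
  finally have "ideal_cong ?R (scal a * (gen i * wordelt u)) (scal a * ((scal xi * gen i + 1) * wordelt w))"
    by (rule ideal_cong_lmult)
  also have "scal a * ((scal xi * gen i + 1) * wordelt w) = scal (a * xi) * wordelt (i # w) + scal a * wordelt w"
    by (simp add: algebra_simps scal_mult wordelt_Cons)
  finally show ?thesis
    using red_span_add[OF red_span_reduced[OF red] red_span_reduced[OF w(1)]] red_span_cong by blast
qed

lemma red_span_gen:
  assumes "x \<in> red_span L" "i \<in> I"
  shows "gen i * x \<in> red_span L"
proof -
  obtain a where a: "Poly_Mapping.keys a \<subseteq> elements" "ideal_cong (hecke_rels I m L) x (red_comb a)"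
    using assms unfolding red_span_def by blast
  have "gen i * red_comb a
      = (\<Sum>w\<in>Poly_Mapping.keys a. scal (Poly_Mapping.lookup a w) * (gen i * wordelt (red_word w)))"
    unfolding red_comb_def sum_distrib_left
    by (rule sum.cong) (simp_all add: scal_commute[of _ "gen i"] flip: mult.assoc)
  also have "\<dots> \<in> red_span L"
    using a(1) red_word assms(2) by (intro red_span_sum red_span_gen_reduced) auto
  finally show ?thesis
    using red_span_cong[OF ideal_cong_lmult[OF a(2)]] by blast
qed

theorem reduced_words_span:
  assumes "in_free I x"
  obtains a where "Poly_Mapping.keys a \<subseteq> elements" "ideal_cong (hecke_rels I m L) x (red_comb a)"
proof -
  have word: "scal a * wordelt u \<in> red_span L" if "u \<in> lists I" for a u
    using that
  proof (induction u)
    case Nil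
    have "reduced []" by (simp add: reduced_def)
    then show ?case by (rule red_span_reduced)
  next
    case (Cons i u)
    then show ?case
      using red_span_gen[of "scal a * wordelt u" L i]
      by (simp add: wordelt_Cons scal_commute[of _ "gen i"] flip: mult.assoc)
  qed
  have "(\<Sum>w\<in>Poly_Mapping.keys x. scal (Poly_Mapping.lookup x w) * wordelt (letters w)) \<in> red_span L"
    using assms unfolding in_free_def by (intro red_span_sum word) (auto simp: in_lists_conv_set)
  then show thesis using that falg_eq_sum[of x] unfolding red_span_def by auto
qed

subsection \<open>The module of functions on the group\<close>

definition xi :: "('i \<Rightarrow> int) \<Rightarrow> 'i \<Rightarrow> laurent" where
  "xi L i = vpow (L i) - vpow (- L i)"

text \<open>The transpose of the right regular representation. Letters outside \<open>I\<close> act by \<open>0\<close>, so that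
  every operator preserves the functions vanishing on \<^term>\<open>elements\<close>.\<close>
definition T :: "('i \<Rightarrow> int) \<Rightarrow> 'i \<Rightarrow> (('v \<Rightarrow> 'v) \<Rightarrow> laurent) \<Rightarrow> ('v \<Rightarrow> 'v) \<Rightarrow> laurent" where
  "T L i h w = (if i \<in> I then h (w \<circ> refl i) + (if w (\<delta> i) \<in> C then 0 else xi L i) * h w else 0)"

lemma T_add: "T L i (\<lambda>w. h w + g w) = (\<lambda>w. T L i h w + T L i g w)"
  by (auto simp: T_def algebra_simps)

lemma T_scale: "T L i (\<lambda>w. a * h w) = (\<lambda>w. a * T L i h w)"
  by (auto simp: T_def algebra_simps)

lemmas rep_T_mult = rep_mult[of "T L" for L, OF T_add T_scale]

lemma act_in_elements: "u \<in> lists I \<Longrightarrow> act u \<in> elements"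
  by (simp add: elements_def)

lemma elements_refl: "w \<in> elements \<Longrightarrow> i \<in> I \<Longrightarrow> w \<circ> refl i \<in> elements"
proof -
  assume "w \<in> elements" "i \<in> I"
  then obtain u where "u \<in> lists I" "w = act u" by (auto simp: elements_def)
  then show ?thesis using act_in_elements[of "i # u"] \<open>i \<in> I\<close> by simp
qed

text \<open>The quadratic and braid identities are established only at points of
  \<open>elements\<close>, where every root has a sign. Since right translation by a generator
  preserves \<open>elements\<close>, they may still be applied inside a product of
  operators.\<close>

lemma T_cong:
  assumes "\<And>w. w \<in> elements \<Longrightarrow> h w = g w" "w \<in> elements"
  shows "T L i h w = T L i g w"
  using assms elements_refl unfolding T_def by simp

lemma foldr_T_cong:
  assumes "\<And>w. w \<in> elements \<Longrightarrow> h w = g w" "w \<in> elements"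
  shows "foldr (T L) u h w = foldr (T L) u g w"
  using assms(2)
proof (induction u arbitrary: w)
  case (Cons i u)
  show ?case using T_cong[OF Cons.IH Cons.prems] by simp
qed (use assms in auto)

text \<open>The root takes opposite signs at \<open>w\<close> and at \<open>w\<close> times the
  reflection, so the coefficient \<open>xi\<close> occurs at exactly one of these two
  points.\<close>

lemma T_quadratic:
  assumes "w \<in> elements" "i \<in> I"
  shows "T L i (T L i h) w = h w + xi L i * T L i h w"
proof -
  obtain u where u: "u \<in> lists I" "w = act u" using assms by (auto simp: elements_def)
  have "w \<circ> refl i \<circ> refl i = w" using assms(2) by (auto simp: fun_eq_iff)
  moreover have "(w \<circ> refl i) (\<delta> i) = - w (\<delta> i)"
    using u act_Cons_self[OF assms(2), of u] by simp
  moreover have "w (\<delta> i) \<in> C \<longleftrightarrow> - w (\<delta> i) \<notin> C"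
    using sign_dichotomy[OF u(1) assms(2)] not_both_signs[OF u(1) assms(2)] u(2) by blast
  ultimately show ?thesis using assms(2) by (simp add: T_def algebra_simps)
qed

lemma rep_T_vanish:
  assumes "\<And>w. w \<in> elements \<Longrightarrow> h w = 0" "w \<in> elements"
  shows "rep (T L) x h w = 0"
proof -
  have "foldr (T L) u h w = 0" for u
    using foldr_T_cong[of h "\<lambda>w. 0 * h w" w L u] assms foldr_T_scale[of "T L" u 0 h, OF T_add T_scale]
    by simp
  then show ?thesis by (simp add: rep_def)
qed

abbreviation braid_at where
  "braid_at L s t k w \<equiv> \<forall>h. foldr (T L) (alt s t k) h w = foldr (T L) (alt t s k) h w"

text \<open>With \<open>\<Lambda> = T_s T_t \<dots> - T_t T_s \<dots>\<close> (\<open>k\<close> factors each) the quadratic relations give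
  \<open>T_s \<Lambda> = \<Lambda> (\<xi> - T_r)\<close> for the letter \<open>r\<close> with which \<open>alt t s k\<close> ends. Hence \<open>\<Lambda> = 0\<close> at \<open>w\<close>
  propagates along the coset of the dihedral subgroup.\<close>
lemma braid_at_refl:
  assumes s: "s \<in> I" and t: "t \<in> I" and w: "w \<in> elements"
    and odd: "odd k \<Longrightarrow> xi L s = xi L t" and Z: "braid_at L s t k w"
  shows "braid_at L s t k (w \<circ> refl s)"
proof (cases k)
  case (Suc l)
  show ?thesis
  proof
    fix h
    let ?F = "foldr (T L)"
    define r where "r = (if even k then s else t)"
    have A: "alt s t k = s # alt t s l" and B: "alt t s k = alt t s l @ [r]"
      and AB: "s # alt t s k = alt s t k @ [r]"
      using alt_Suc_right[of t s l] alt_Suc_right[of s t k] by (simp_all add: Suc r_def)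
    have r: "r \<in> I" "xi L r = xi L s" using s t odd by (auto simp: r_def)
    have "T L s (?F (alt s t k) h) w = ?F (alt t s l) h w + xi L s * ?F (alt s t k) h w"
      using T_quadratic[OF w s] by (simp add: A)
    moreover have "T L s (?F (alt t s k) h) w = ?F (alt t s l) h w + xi L s * ?F (alt t s k) h w"
    proof -
      have "T L s (?F (alt t s k) h) w = ?F (s # alt t s k) h w" by simp
      also have "\<dots> = ?F (alt s t k) (T L r h) w" unfolding AB by simp
      also have "\<dots> = ?F (alt t s k) (T L r h) w" using Z by blast
      also have "\<dots> = ?F (alt t s l) (T L r (T L r h)) w" unfolding B by simp
      also have "\<dots> = ?F (alt t s l) (\<lambda>w. h w + xi L r * T L r h w) w"
        using w T_quadratic r(1) by (intro foldr_T_cong) auto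
      also have "\<dots> = ?F (alt t s l) h w + xi L r * ?F (alt t s l) (T L r h) w"
        using foldr_T_add[of "T L", OF T_add T_scale] foldr_T_scale[of "T L", OF T_add T_scale] by simp
      finally show ?thesis using r(2) by (simp add: B)
    qed
    moreover have Zh: "?F (alt s t k) h w = ?F (alt t s k) h w" using Z by blast
    ultimately have "T L s (?F (alt s t k) h) w = T L s (?F (alt t s k) h) w" by simp
    \<comment> \<open>The operator of \<open>s\<close> evaluated at \<open>w\<close> involves only
      the values at \<open>w\<close> and at \<open>w\<close> times the reflection. Equality of the
      first two kinds of value therefore gives equality of the third.\<close>
    with Zh show "?F (alt s t k) h (w \<circ> refl s) = ?F (alt t s k) h (w \<circ> refl s)"
      using s by (simp add: T_def)
  qed
qed simp

text \<open>Climbing from a minimal coset representative: up to length \<open>m s t\<close> every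
  root that is met is positive, so no \<open>xi\<close> term appears and each operator is a plain
  translation.\<close>

lemma foldr_T_alt:
  assumes st: "s \<in> I" "t \<in> I" "s \<noteq> t" and x: "act x (\<delta> s) \<in> C" "act x (\<delta> t) \<in> C"
    and le: "enat (j + l) \<le> m s t"
  shows "foldr (T L) (alt s t l) h (act (alt t s j @ x))
    = h (act ((if even l then alt t s (j + l) else alt s t (j + l)) @ x))"
  using assms
proof (induction l arbitrary: s t j)
  case (Suc l)
  have "enat j < m s t" using Suc.prems(6) by (metis add_Suc_right enat_ord_simps(2) le_add1 le_imp_less_Suc less_le_trans)
  then have "act (alt t s j @ x) (\<delta> s) \<in> C"
    using act_alt_root_in_C Suc.prems by blast
  then have "foldr (T L) (alt s t (Suc l)) h (act (alt t s j @ x))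
      = foldr (T L) (alt t s l) h (act (alt s t (Suc j) @ x))"
    using Suc.prems(1) by (simp add: T_def)
  also have "\<dots> = h (act ((if even l then alt s t (Suc j + l) else alt t s (Suc j + l)) @ x))"
    using Suc.prems m_sym[of s t] by (intro Suc.IH) simp_all
  finally show ?case by (cases "even l") (simp_all del: alt.simps)
qed simp

text \<open>At the minimal representative \<open>x\<close> of the dihedral coset both sides evaluate
  \<open>h\<close> at the same top element; \<open>braid_at_refl\<close> then carries the identity
  from \<open>x\<close> to \<open>w\<close>.\<close>

lemma braid_at_all:
  assumes st: "s \<in> I" "t \<in> I" "s \<noteq> t" and k: "m s t = enat k" and w: "w \<in> elements"
    and odd: "odd k \<Longrightarrow> xi L s = xi L t"
  shows "braid_at L s t k w"
proof -
  obtain u where u: "u \<in> lists I" "act u = w" using w by (auto simp: elements_def)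
  obtain u' where u': "reduced u'" "act u' = w" using exists_reduced[OF u(1)] u(2) by metis
  obtain d l x where d: "d = alt s t l \<or> d = alt t s l" "reduced x" "act (d @ x) = act u'"
    and min: "\<And>r w. r \<in> {s, t} \<Longrightarrow> w \<in> lists I \<Longrightarrow> act w = act (r # x) \<Longrightarrow> length x \<le> length w"
    using dihedral_decomposition[OF u'(1) st] by metis
  have x: "x \<in> lists I" using reduced_in_lists[OF d(2)] .
  have xC: "act x (\<delta> s) \<in> C" "act x (\<delta> t) \<in> C"
    using root_positive[OF d(2)] st min by auto
  have base: "braid_at L s t k (act x)"
    using foldr_T_alt[OF st xC, of 0 k] foldr_T_alt[OF st(2,1) st(3)[symmetric] xC(2,1), of 0 k]
      k m_sym[OF st(1,2)] act_alt_braid[OF st k] by (simp add: act_append)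
  have "braid_at L s t k (act (d' @ x))" if "d' \<in> lists {s, t}" for d'
    using that
  proof (induction d')
    case (Cons i d')
    have "d' \<in> lists I" using Cons.hyps st lists_mono[of "{s, t}" I] by blast
    then have el: "act (d' @ x) \<in> elements" using x by (intro act_in_elements) simp
    have "braid_at L t s k (act (d' @ x) \<circ> refl t)"
      using Cons.IH odd by (intro braid_at_refl[OF st(2,1) el]) simp_all
    moreover have "braid_at L s t k (act (d' @ x) \<circ> refl s)"
      using Cons.IH odd by (intro braid_at_refl[OF st(1,2) el]) simp_all
    moreover have "i = s \<or> i = t" using Cons.hyps by simp
    moreover have "act ((i # d') @ x) = act (d' @ x) \<circ> refl i" by simp
    ultimately show ?case by metis
  qed (use base in simp)
  moreover have "d \<in> lists {s, t}" using d(1) alt_in_lists[of s "{s, t}" t] alt_in_lists[of t "{s, t}" s] by auto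
  ultimately show ?thesis using d(3) u'(2) by metis
qed

theorem rep_T_hecke_ideal:
  assumes odd: "\<And>s t k. s \<in> I \<Longrightarrow> t \<in> I \<Longrightarrow> m s t = enat k \<Longrightarrow> odd k \<Longrightarrow> L s = L t"
    and "x \<in> hecke_ideal I m L" "w \<in> elements"
  shows "rep (T L) x h w = 0"
  using assms(2,3) unfolding hecke_ideal_def
proof (induction x arbitrary: h w)
  case (base r)
  from base(1) consider (quad) s where "s \<in> I" "r = (gen s - scal (vpow (L s))) * (gen s + scal (vpow (- L s)))"
    | (braid) s t k where "s \<in> I" "t \<in> I" "s \<noteq> t" "m s t = enat k" "r = wordelt (alt s t k) - wordelt (alt t s k)"
    unfolding hecke_rels_def by blast
  then show ?case
  proof cases
    case quad
    have r: "r = wordelt [s, s] - (scal (xi L s) * wordelt [s] + wordelt [])"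
      unfolding quad(2) hecke_quadratic by (simp add: wordelt_Cons xi_def)
    show ?thesis
      unfolding r rep_diff rep_add rep_term rep_wordelt using T_quadratic[OF base(2) quad(1)] by simp
  next
    case braid
    have "odd k \<Longrightarrow> xi L s = xi L t" using odd[OF braid(1,2,4)] by (simp add: xi_def)
    then show ?thesis
      unfolding braid(5) rep_diff rep_wordelt using braid_at_all[OF braid(1-4) base(2)] by simp
  qed
next
  case (lmult a c)
  \<comment> \<open>The inner function is known to vanish on \<open>elements\<close> only, and every
    operator preserves such functions.\<close>
  show ?case unfolding rep_T_mult
    by (rule rep_T_vanish) (use lmult in auto)
next
  case (rmult a c)
  then show ?case unfolding rep_T_mult by blast
qed (simp_all add: rep_0 rep_add)

lemma eval1_T: "i \<in> I \<Longrightarrow> eval1 (T L i h w) = eval1 (h (w \<circ> refl i))"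
  by (simp add: T_def eval1_add eval1_mult eval1_diff xi_def)

end

section \<open>The contraction homomorphism\<close>

lemma cox_eq_rev: "w \<in> lists S \<Longrightarrow> cox_eq S m (w @ rev w) []"
proof (induction w)
  case (Cons s w)
  have "cox_eq S m ([s] @ (w @ rev w) @ [s]) ([s] @ [] @ [s])"
    using Cons by (intro cox_eq.ctx) simp
  moreover have "cox_eq S m [s, s] []" using Cons.prems by (intro cox_eq.invol) simp
  ultimately show ?case using cox_eq.trans by fastforce
qed (simp add: cox_eq.refl)

text \<open>For k = 2j + 1 and \<open>w = alt s t (2 * j)\<close> the braid relation reads w s = t
  w, so \<open>w\<close> conjugates \<open>s\<close> to \<open>t\<close>.\<close>

lemma weight_eq_if_odd:
  assumes "weight_function S m L" "s \<in> S" "t \<in> S" "m s t = enat k" "odd k"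
  shows "L s = L t"
proof (cases "s = t")
  case False
  obtain j where k: "k = Suc (2 * j)" using assms(5) by (metis oddE Suc_eq_plus1)
  define w where "w = alt s t (2 * j)"
  have w: "w \<in> lists S" unfolding w_def using assms by (intro alt_in_lists)
  have "alt s t k = w @ [s]" "alt t s k = [t] @ w"
    using alt_Suc_right[of s t "2 * j"] by (simp_all add: k w_def)
  then have "cox_eq S m (w @ [s]) ([t] @ w)"
    using cox_eq.braid[of s S t m k] assms False by simp
  then have "cox_eq S m (w @ [s] @ rev w) ([t] @ w @ rev w)"
    using cox_eq.ctx[of S m "w @ [s]" "[t] @ w" "[]" "rev w"] by simp
  moreover have "cox_eq S m ([t] @ w @ rev w) [t]"
    using cox_eq.ctx[OF cox_eq_rev[OF w], of m "[t]" "[]"] by simp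
  ultimately have "cox_conj S m s t"
    unfolding cox_conj_def using w cox_eq.trans by blast
  then show ?thesis using assms unfolding weight_function_def by blast
qed simp

section \<open>Inverses and conjugation in the Hecke algebra\<close>

definition gen_inv :: "('s \<Rightarrow> int) \<Rightarrow> 's \<Rightarrow> 's falg" where
  "gen_inv L s = gen s - scal (vpow (L s) - vpow (- L s))"

lemma gen_inv_cong:
  assumes "s \<in> S"
  shows "ideal_cong (hecke_rels S m L) (gen s * gen_inv L s) 1"
    and "ideal_cong (hecke_rels S m L) (gen_inv L s * gen s) 1"
proof -
  define \<xi> where "\<xi> = vpow (L s) - vpow (- L s)"
  have "ideal_cong (hecke_rels S m L) (gen s * gen s - scal \<xi> * gen s) (scal \<xi> * gen s + 1 - scal \<xi> * gen s)"
    unfolding \<xi>_def by (rule ideal_cong_diff[OF hecke_quadratic_cong[OF assms] ideal_cong_refl])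
  then show "ideal_cong (hecke_rels S m L) (gen s * gen_inv L s) 1"
    "ideal_cong (hecke_rels S m L) (gen_inv L s * gen s) 1"
    using scal_commute[of \<xi> "gen s"] by (simp_all add: gen_inv_def algebra_simps flip: \<xi>_def)
qed

lemma inverse_unique_cong:
  assumes "ideal_cong R (y * x) 1" "ideal_cong R (x * z) 1"
  shows "ideal_cong R y z"
proof -
  have "ideal_cong R (y * 1) (y * (x * z))"
    by (rule ideal_cong_lmult[OF ideal_cong_sym[OF assms(2)]])
  also have "y * (x * z) = (y * x) * z" by (simp add: mult.assoc)
  also have "ideal_cong R \<dots> (1 * z)" using assms(1) by (rule ideal_cong_rmult)
  finally show ?thesis by simp
qed

lemma conjugate_alt_cong:
  assumes pq: "ideal_cong R (p * q) 1" "ideal_cong R (q * p) 1"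
    and "ideal_cong R (g s) (p * gen a * q)" "ideal_cong R (g t) (p * gen b * q)"
  shows "ideal_cong R (prod_list (map g (alt s t k))) (p * wordelt (alt a b k) * q)"
  using assms(3,4)
proof (induction k arbitrary: s t a b)
  case 0
  then show ?case using ideal_cong_sym[OF pq(1)] by simp
next
  case (Suc k)
  let ?W = "wordelt (alt b a k)"
  have "ideal_cong R (prod_list (map g (alt s t (Suc k)))) ((p * gen a * q) * (p * ?W * q))"
    using Suc.IH[OF Suc.prems(2,1)] Suc.prems(1) by (simp add: ideal_cong_mult)
  also have "(p * gen a * q) * (p * ?W * q) = (p * gen a) * (q * p) * (?W * q)"
    by (simp only: mult.assoc)
  also have "ideal_cong R \<dots> ((p * gen a) * 1 * (?W * q))"
    by (intro ideal_cong_rmult ideal_cong_lmult pq)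
  finally show ?case by (simp add: wordelt_Cons mult.assoc)
qed

text \<open>A braid relation is transported by one invertible \<open>p\<close> that conjugates both
  generators at once.\<close>

lemma conjugate_braid_cong:
  assumes "ideal_cong R (p * q) 1" "ideal_cong R (q * p) 1"
    and "ideal_cong R (g s) (p * gen a * q)" "ideal_cong R (g t) (p * gen b * q)"
    and "ideal_cong R (wordelt (alt a b k)) (wordelt (alt b a k))"
  shows "ideal_cong R (prod_list (map g (alt s t k))) (prod_list (map g (alt t s k)))"
proof -
  have "ideal_cong R (prod_list (map g (alt s t k))) (p * wordelt (alt a b k) * q)"
    using assms by (intro conjugate_alt_cong)
  also have "ideal_cong R \<dots> (p * wordelt (alt b a k) * q)"
    by (intro ideal_cong_rmult ideal_cong_lmult assms)
  also have "ideal_cong R \<dots> (prod_list (map g (alt t s k)))"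
    using assms by (intro ideal_cong_sym[OF conjugate_alt_cong])
  finally show ?thesis .
qed

lemma commuting_gens_cong:
  assumes "coxeter_matrix S m" "s \<in> S" "t \<in> S" "m s t = 2"
  shows "ideal_cong (hecke_rels S m L) (gen s * gen t) (gen t * gen s)"
proof -
  have "m s s = 1" using assms unfolding coxeter_matrix_def by blast
  then have "s \<noteq> t" using assms(4) by auto
  then have "ideal_cong (hecke_rels S m L) (wordelt (alt s t 2)) (wordelt (alt t s 2))"
    using assms by (intro hecke_braid_cong) (simp_all add: numeral_eq_enat)
  then show ?thesis by (simp add: numeral_2_eq_2 wordelt_Cons)
qed

subsection \<open>The geometric representation and its contraction\<close>

instantiation poly_mapping :: (type, real_vector) real_vector
begin

definition scaleR_poly_mapping :: "real \<Rightarrow> ('a \<Rightarrow>\<^sub>0 'b) \<Rightarrow> 'a \<Rightarrow>\<^sub>0 'b" where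
  "scaleR_poly_mapping r = Poly_Mapping.map (scaleR r)"

lemma lookup_scaleR: "Poly_Mapping.lookup (r *\<^sub>R x) k = r *\<^sub>R Poly_Mapping.lookup x k"
  unfolding scaleR_poly_mapping_def by transfer (simp add: when_def)

instance
  by standard (rule poly_mapping_eqI, simp add: lookup_scaleR lookup_add scaleR_add_right scaleR_add_left)+

end

definition simple_root :: "'s \<Rightarrow> 's \<Rightarrow>\<^sub>0 real" where
  "simple_root s = Poly_Mapping.single s 1"

definition cartan :: "('s \<Rightarrow> 's \<Rightarrow> enat) \<Rightarrow> 's \<Rightarrow> 's \<Rightarrow> real" where
  "cartan m s t = (if s = t then 2 else case m s t of enat k \<Rightarrow> - 2 * cos (pi / real k) | \<infinity> \<Rightarrow> - 2)"

definition form :: "('s \<Rightarrow> 's \<Rightarrow> enat) \<Rightarrow> 's \<Rightarrow> ('s \<Rightarrow>\<^sub>0 real) \<Rightarrow> real" where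
  "form m s x = (\<Sum>t\<in>Poly_Mapping.keys x. Poly_Mapping.lookup x t * cartan m s t)"

definition nonneg_cone :: "('s \<Rightarrow>\<^sub>0 real) set" where
  "nonneg_cone = {x. \<forall>s. 0 \<le> Poly_Mapping.lookup x s}"

fun contract_root :: "'s \<Rightarrow> 's \<Rightarrow> 's option \<Rightarrow> 's \<Rightarrow>\<^sub>0 real" where
  "contract_root sp sm None = simple_root sp + simple_root sm"
| "contract_root sp sm (Some s) = simple_root s"

fun contract_form :: "('s \<Rightarrow> 's \<Rightarrow> enat) \<Rightarrow> 's \<Rightarrow> 's \<Rightarrow> 's option \<Rightarrow> ('s \<Rightarrow>\<^sub>0 real) \<Rightarrow> real" where
  "contract_form m sp sm None x = form m sp x + form m sm x"
| "contract_form m sp sm (Some s) x = form m s x"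

lemma form_linear: "linear (form m s)"
proof (rule linearI)
  show "form m s (x + y) = form m s x + form m s y" for x y
    unfolding form_def by (rule setsum_keys_plus_distrib) (simp_all add: algebra_simps)
  show "form m s (r *\<^sub>R x) = r *\<^sub>R form m s x" for r x
  proof -
    have "form m s (r *\<^sub>R x)
        = (\<Sum>t\<in>Poly_Mapping.keys x. Poly_Mapping.lookup (r *\<^sub>R x) t * cartan m s t)"
      unfolding form_def by (rule sum.mono_neutral_left) (auto simp: in_keys_iff lookup_scaleR)
    then show ?thesis by (simp add: form_def lookup_scaleR sum_distrib_left mult.assoc)
  qed
qed

lemma form_root [simp]: "form m s (simple_root t) = cartan m s t"
  by (simp add: form_def simple_root_def)

lemma contract_form_linear: "linear (contract_form m sp sm i)"
proof (cases i)
  case None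
  have "linear (\<lambda>x. form m sp x + form m sm x)"
    using form_linear form_linear by (rule linear_compose_add)
  moreover have "contract_form m sp sm i = (\<lambda>x. form m sp x + form m sm x)"
    using None by auto
  ultimately show ?thesis by simp
next
  case (Some s)
  then have "contract_form m sp sm i = form m s" by auto
  then show ?thesis using form_linear by simp
qed

lemma nonneg_cone_add: "x \<in> nonneg_cone \<Longrightarrow> y \<in> nonneg_cone \<Longrightarrow> x + y \<in> nonneg_cone"
  and nonneg_cone_scale: "x \<in> nonneg_cone \<Longrightarrow> 0 \<le> a \<Longrightarrow> a *\<^sub>R x \<in> nonneg_cone"
  and root_in_nonneg_cone: "simple_root s \<in> nonneg_cone"
  by (auto simp: nonneg_cone_def lookup_add lookup_scaleR simple_root_def lookup_single when_def)

lemma nonneg_cone_pointed: "x \<in> nonneg_cone \<Longrightarrow> - x \<in> nonneg_cone \<Longrightarrow> x = 0"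
  by (intro poly_mapping_eqI) (auto simp: nonneg_cone_def intro: antisym)

lemma cartan_self [simp]: "cartan m s s = 2"
  by (simp add: cartan_def)

lemma cartan_2: "s \<noteq> t \<Longrightarrow> m s t = 2 \<Longrightarrow> cartan m s t = 0"
  by (simp add: cartan_def numeral_eq_enat)

lemma cartan_3: "s \<noteq> t \<Longrightarrow> m s t = 3 \<Longrightarrow> cartan m s t = - 1"
  by (simp add: cartan_def numeral_eq_enat cos_60)

text \<open>Two such entries add up to at most -2, the bound required by \<open>f_inf\<close> when
  \<open>s\<close> is joined to both ends of the edge.\<close>

lemma cartan_ge_3:
  assumes "s \<noteq> t" "3 \<le> m s t"
  shows "cartan m s t \<le> - 1"
proof (cases "m s t")
  case (enat k)
  then have k: "3 \<le> k" using assms(2) by (simp add: numeral_eq_enat)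
  then have "cos (pi / 3) \<le> cos (pi / real k)"
    by (intro cos_monotone_0_pi_le) (auto simp: field_simps)
  then show ?thesis using enat assms(1) by (simp add: cartan_def cos_60)
qed (use assms in \<open>simp add: cartan_def\<close>)

locale edge =
  fixes S :: "'s set" and m :: "'s \<Rightarrow> 's \<Rightarrow> enat" and sp sm :: 's
  assumes cox: "coxeter_matrix S m"
    and sp: "sp \<in> S" and sm: "sm \<in> S" and sp_sm: "sp \<noteq> sm" and m_edge: "m sp sm = 3"
begin

lemma m_sym: "s \<in> S \<Longrightarrow> t \<in> S \<Longrightarrow> m s t = m t s"
  using cox unfolding coxeter_matrix_def by blast

lemma m_ge_2:
  assumes "s \<in> S" "t \<in> S" "s \<noteq> t"
  shows "2 \<le> m s t"
proof -
  have "1 \<le> m s t" "m s t \<noteq> 1" using cox assms unfolding coxeter_matrix_def by blast+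
  then show ?thesis by (cases "m s t") (auto simp: numeral_eq_enat one_enat_def)
qed

lemma m_2_or_ge_3:
  assumes "s \<in> S" "t \<in> S" "s \<noteq> t"
  shows "m s t = 2 \<or> 3 \<le> m s t"
  using m_ge_2[OF assms] by (cases "m s t") (auto simp: numeral_eq_enat)

lemma cartan_sym: "s \<in> S \<Longrightarrow> t \<in> S \<Longrightarrow> cartan m s t = cartan m t s"
  using m_sym unfolding cartan_def by simp

lemma contract_matrix_cases:
  assumes "s \<in> S" "s \<noteq> sp" "s \<noteq> sm"
  obtains "m s sp = 2" "contract_matrix m sp sm None (Some s) = m s sm"
  | "m s sm = 2" "contract_matrix m sp sm None (Some s) = m s sp"
  | "3 \<le> m s sp" "3 \<le> m s sm" "contract_matrix m sp sm None (Some s) = \<infinity>"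
proof -
  have "2 + x - 2 = x" "x + 2 - 2 = x" for x :: enat
    by (cases x; simp add: numeral_eq_enat)+
  moreover have "m s sp = 2 \<or> 3 \<le> m s sp" "m s sm = 2 \<or> 3 \<le> m s sm"
    using m_2_or_ge_3 assms sp sm by auto
  moreover have "\<not> 3 \<le> (2 :: enat)" by (simp add: numeral_eq_enat)
  ultimately show thesis using that by (metis contract_matrix.simps(4))
qed

lemma contract_matrix_sym: "contract_matrix m sp sm (Some s) None = contract_matrix m sp sm None (Some s)"
  by simp

lemma in_contract_set: "Some s \<in> contract_set S sp sm \<longleftrightarrow> s \<in> S \<and> s \<noteq> sp \<and> s \<noteq> sm"
  by (auto simp: contract_set_def)

lemma contract_matrix_coxeter: "coxeter_matrix (contract_set S sp sm) (contract_matrix m sp sm)"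
proof -
  have ge2: "2 \<le> contract_matrix m sp sm None (Some s)" if "s \<in> S" "s \<noteq> sp" "s \<noteq> sm" for s
    using that(1,2,3) by (rule contract_matrix_cases) (use m_ge_2 sp sm that in auto)
  have *: "1 \<le> x \<and> x \<noteq> 1" if "2 \<le> x" for x :: enat
    using that by (cases x) (auto simp: numeral_eq_enat one_enat_def)
  have "contract_matrix m sp sm i j = contract_matrix m sp sm j i \<and> 1 \<le> contract_matrix m sp sm i j
      \<and> (contract_matrix m sp sm i j = 1 \<longleftrightarrow> i = j)"
    if "i \<in> contract_set S sp sm" "j \<in> contract_set S sp sm" for i j
  proof (cases i; cases j)
    fix s t assume "i = Some s" "j = Some t"
    moreover from this have "s \<in> S" "t \<in> S" using that by (auto simp: in_contract_set)
    then have "m s t = m t s \<and> 1 \<le> m s t \<and> (m s t = 1 \<longleftrightarrow> s = t)"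
      using cox unfolding coxeter_matrix_def by blast
    ultimately show ?thesis by (metis contract_matrix.simps(2) option.inject)
  next
    fix s assume "i = None" "j = Some s"
    then show ?thesis using *[OF ge2[of s]] that by (simp add: in_contract_set)
  next
    fix s assume "i = Some s" "j = None"
    then show ?thesis using *[OF ge2[of s]] that by (simp add: in_contract_set)
  qed simp
  then show ?thesis unfolding coxeter_matrix_def by blast
qed

text \<open>The pairing of beta with a simple root is the sum of two Cartan entries. An entry for m
  = 2 contributes 0, leaving the other cosine; two entries for m at least 3 contribute at most -1
  each. This matches the three cases of the contracted matrix.\<close>

lemma contract_form_None_root:
  assumes "s \<in> S" "s \<noteq> sp" "s \<noteq> sm"
  shows "contract_matrix m sp sm None (Some s) = enat k \<Longrightarrow>
      contract_form m sp sm None (simple_root s) = - 2 * cos (pi / real k)"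
    and "contract_matrix m sp sm None (Some s) = \<infinity> \<Longrightarrow> contract_form m sp sm None (simple_root s) \<le> - 2"
proof -
  have form: "contract_form m sp sm None (simple_root s) = cartan m s sp + cartan m s sm"
    using cartan_sym assms(1) sp sm by simp
  show "contract_form m sp sm None (simple_root s) = - 2 * cos (pi / real k)"
    if k: "contract_matrix m sp sm None (Some s) = enat k"
    using assms
  proof (cases rule: contract_matrix_cases)
    case 1
    then show ?thesis using k assms cartan_2[of s sp m] unfolding form by (simp add: cartan_def)
  next
    case 2
    then show ?thesis using k assms cartan_2[of s sm m] unfolding form by (simp add: cartan_def)
  qed (use k in simp)
  show "contract_form m sp sm None (simple_root s) \<le> - 2"
    if k: "contract_matrix m sp sm None (Some s) = \<infinity>"
    using assms
  proof (cases rule: contract_matrix_cases)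
    case 1
    then show ?thesis using k assms cartan_2[of s sp m] unfolding form by (simp add: cartan_def)
  next
    case 2
    then show ?thesis using k assms cartan_2[of s sm m] unfolding form by (simp add: cartan_def)
  next
    case 3
    then show ?thesis using assms cartan_ge_3[of s sp m] cartan_ge_3[of s sm m] unfolding form by simp
  qed
qed

lemma contract_form_sym:
  assumes "i \<in> contract_set S sp sm" "j \<in> contract_set S sp sm"
  shows "contract_form m sp sm i (contract_root sp sm j) = contract_form m sp sm j (contract_root sp sm i)"
  using assms sp sm cartan_sym
  by (cases i; cases j) (simp_all add: in_contract_set linear_add[OF form_linear])

sublocale E: root_basis S m simple_root "form m" nonneg_cone
proof (rule root_basis.intro)
  show "form m s (simple_root t) = form m t (simple_root s)" if "s \<in> S" "t \<in> S" for s t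
    using that cartan_sym by simp
  show "form m s (simple_root t) = - 2 * cos (pi / real k)" if "s \<noteq> t" "m s t = enat k" for s t k
    using that by (simp add: cartan_def)
  show "form m s (simple_root t) \<le> - 2" if "s \<in> S" "t \<in> S" "m s t = \<infinity>" for s t
  proof -
    have "m s s = 1" using cox that(1) unfolding coxeter_matrix_def by blast
    then have "s \<noteq> t" using that(3) by auto
    then show ?thesis using that(3) by (simp add: cartan_def)
  qed
qed (use cox form_linear nonneg_cone_add nonneg_cone_scale nonneg_cone_pointed root_in_nonneg_cone in auto)

text \<open>Ambient space and cone are those of \<open>E\<close>, so elements of the contracted
  group are maps that can be compared directly with elements of the original one.\<close>

sublocale E': root_basis "contract_set S sp sm" "contract_matrix m sp sm" "contract_root sp sm"
  "contract_form m sp sm" nonneg_cone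
proof (rule root_basis.intro)
  let ?I = "contract_set S sp sm" and ?n = "contract_matrix m sp sm"
  let ?f = "contract_form m sp sm" and ?r = "contract_root sp sm"
  \<comment> \<open>For \<open>None\<close> the value is 2 - 1 - 1 + 2, the entries -1 coming from
    \<open>m sp sm = 3\<close>.\<close>
  show "?f i (?r i) = 2" if "i \<in> ?I" for i
    using cartan_3[of sp sm m, OF sp_sm m_edge] cartan_sym[OF sp sm]
    by (cases i) (simp_all add: linear_add[OF form_linear])
  have Some_None: "?f (Some s) (?r None) = ?f None (simple_root s)" if "Some s \<in> ?I" for s
    using contract_form_sym[OF that, of None] by (simp add: contract_set_def)
  show "?f i (?r j) = - 2 * cos (pi / real k)" if "i \<in> ?I" "j \<in> ?I" "i \<noteq> j" "?n i j = enat k" for i j k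
  proof (cases i; cases j)
    fix s t assume "i = Some s" "j = Some t"
    then show ?thesis using that by (simp add: cartan_def)
  next
    fix s assume "i = None" "j = Some s"
    then show ?thesis using that contract_form_None_root(1)[of s k] by (simp add: in_contract_set)
  next
    fix s assume ij: "i = Some s" "j = None"
    have s: "s \<in> S" "s \<noteq> sp" "s \<noteq> sm" using that(1) ij by (simp_all add: in_contract_set)
    have n: "?n None (Some s) = enat k" using that ij by simp
    have "?f i (?r j) = ?f None (simple_root s)" using Some_None that(1) unfolding ij .
    with contract_form_None_root(1)[OF s n] show ?thesis by (simp only:)
  qed (use that in simp)
  show "?f i (?r j) \<le> - 2" if "i \<in> ?I" "j \<in> ?I" "?n i j = \<infinity>" for i j
  proof (cases i; cases j)
    fix s t assume "i = Some s" "j = Some t"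
    then show ?thesis using that E.f_inf[of s t] by (simp add: in_contract_set)
  next
    fix s assume "i = None" "j = Some s"
    then show ?thesis using that contract_form_None_root(2)[of s] by (simp add: in_contract_set)
  next
    fix s assume ij: "i = Some s" "j = None"
    have s: "s \<in> S" "s \<noteq> sp" "s \<noteq> sm" using that(1) ij by (simp_all add: in_contract_set)
    have n: "?n None (Some s) = \<infinity>" using that ij by simp
    have "?f i (?r j) = ?f None (simple_root s)" using Some_None that(1) unfolding ij .
    with contract_form_None_root(2)[OF s n] show ?thesis by (simp only:)
  qed (use that in simp)
  show "?r i \<in> nonneg_cone" for i
    by (cases i) (simp_all add: root_in_nonneg_cone nonneg_cone_add)
qed (use contract_matrix_coxeter contract_form_linear contract_form_sym
      nonneg_cone_add nonneg_cone_scale nonneg_cone_pointed in auto)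

lemma contract_refl_Some: "E'.refl (Some s) = E.refl s"
  by (simp add: fun_eq_iff E.refl_def E'.refl_def)

lemma contract_refl_None: "E'.refl None = E.refl sp \<circ> E.refl sm \<circ> E.refl sp"
proof
  fix x
  have c: "cartan m sp sm = - 1" "cartan m sm sp = - 1"
    using cartan_3[of sp sm m, OF sp_sm m_edge] cartan_sym[OF sp sm] by auto
  show "E'.refl None x = (E.refl sp \<circ> E.refl sm \<circ> E.refl sp) x"
    by (simp add: E.refl_def E'.refl_def linear_add[OF form_linear]
        linear_diff[OF form_linear] linear_scale[OF form_linear] c algebra_simps)
qed

end

subsection \<open>Injectivity\<close>

locale weighted_edge = edge S m sp sm
  for S :: "'s set" and m :: "'s \<Rightarrow> 's \<Rightarrow> enat" and sp sm :: 's +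
  fixes L :: "'s \<Rightarrow> int" and y :: "'s falg"
  assumes weight: "weight_function S m L"
    and sp_y: "ideal_cong (hecke_rels S m L) (gen sp * y) 1"
    and y_sp: "ideal_cong (hecke_rels S m L) (y * gen sp) 1"
begin

abbreviation hcong (infix "\<approx>" 50) where "x \<approx> z \<equiv> ideal_cong (hecke_rels S m L) x z"

abbreviation phi :: "'s option falg \<Rightarrow> 's falg" where "phi \<equiv> free_hom (phi_gen sp sm y)"

section \<open>Compatibility of the contraction map with the Hecke relations\<close>

lemma L_eq: "L sm = L sp"
  using weight_eq_if_odd[of S m L sp sm 3] weight sp sm m_edge by (simp add: numeral_eq_enat)

text \<open>The braid relation of the edge turns T_+ T_- T_+^{-1} into T_-^{-1} T_+ T_-. This second
  form serves the generators that commute with T_-.\<close>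

lemma phi_gen_None_conj_sm: "phi_gen sp sm y None \<approx> gen_inv L sm * gen sp * gen sm"
proof -
  let ?P = "gen sp" and ?Q = "gen sm" and ?z = "gen_inv L sm"
  have "wordelt (alt sp sm 3) \<approx> wordelt (alt sm sp 3)"
    using sp sm sp_sm m_edge by (intro hecke_braid_cong) (simp_all add: numeral_eq_enat)
  then have PQP: "?P * ?Q * ?P \<approx> ?Q * ?P * ?Q"
    by (simp add: numeral_3_eq_3 wordelt_Cons mult.assoc)
  have "1 * (?P * ?Q * y) \<approx> (?z * ?Q) * (?P * ?Q * y)"
    by (rule ideal_cong_rmult[OF ideal_cong_sym[OF gen_inv_cong(2)[OF sm]]])
  also have "(?z * ?Q) * (?P * ?Q * y) = ?z * (?Q * ?P * ?Q) * y" by (simp only: mult.assoc)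
  also have "\<dots> \<approx> ?z * (?P * ?Q * ?P) * y"
    by (rule ideal_cong_rmult[OF ideal_cong_lmult[OF ideal_cong_sym[OF PQP]]])
  also have "?z * (?P * ?Q * ?P) * y = (?z * ?P * ?Q) * (?P * y)" by (simp only: mult.assoc)
  also have "\<dots> \<approx> (?z * ?P * ?Q) * 1" by (rule ideal_cong_lmult[OF sp_y])
  finally show ?thesis by simp
qed

lemma gen_conj_sp:
  assumes "s \<in> S" "m s sp = 2"
  shows "gen s \<approx> gen sp * gen s * y"
proof -
  have "gen s * 1 \<approx> gen s * (gen sp * y)" by (rule ideal_cong_lmult[OF ideal_cong_sym[OF sp_y]])
  also have "gen s * (gen sp * y) = gen s * gen sp * y" by (simp only: mult.assoc)
  also have "\<dots> \<approx> gen sp * gen s * y"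
    by (rule ideal_cong_rmult[OF commuting_gens_cong[where m=m, OF cox assms(1) sp assms(2)]])
  finally show ?thesis by simp
qed

lemma gen_conj_sm:
  assumes "s \<in> S" "m s sm = 2"
  shows "gen s \<approx> gen_inv L sm * gen s * gen sm"
proof -
  have "1 * gen s \<approx> (gen_inv L sm * gen sm) * gen s"
    by (rule ideal_cong_rmult[OF ideal_cong_sym[OF gen_inv_cong(2)[OF sm]]])
  also have "(gen_inv L sm * gen sm) * gen s = gen_inv L sm * (gen sm * gen s)" by (simp only: mult.assoc)
  also have "\<dots> \<approx> gen_inv L sm * (gen s * gen sm)"
    by (rule ideal_cong_lmult[OF ideal_cong_sym[OF commuting_gens_cong[where m=m, OF cox assms(1) sm assms(2)]]])
  finally show ?thesis by (simp add: mult.assoc)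
qed

text \<open>A finite entry means that \<open>s\<close> commutes with an end of the edge. If this is
  \<open>sp\<close>, conjugation by T_+ fixes T_s and takes T_- to the image of T'_{s_0}; if it is
  \<open>sm\<close>, conjugation by T_-^{-1} fixes T_s and takes T_+ there. Either way a braid
  relation of H_S is transported.\<close>

lemma phi_braid_None:
  assumes s: "s \<in> S" "s \<noteq> sp" "s \<noteq> sm" and k: "contract_matrix m sp sm None (Some s) = enat k"
  shows "phi (wordelt (alt None (Some s) k)) \<approx> phi (wordelt (alt (Some s) None k))"
  using s unfolding free_hom_wordelt
proof (cases rule: contract_matrix_cases)
  case 1
  have "m sm s = enat k" using 1 k m_sym s sm by simp
  then have "wordelt (alt sm s k) \<approx> wordelt (alt s sm k)" using s sm by (intro hecke_braid_cong) auto
  moreover have "phi_gen sp sm y (Some s) \<approx> gen sp * gen s * y" using gen_conj_sp[OF s(1) 1(1)] by simp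
  moreover have "phi_gen sp sm y None \<approx> gen sp * gen sm * y" by simp
  ultimately show "prod_list (map (phi_gen sp sm y) (alt None (Some s) k))
      \<approx> prod_list (map (phi_gen sp sm y) (alt (Some s) None k))"
    using sp_y y_sp by (intro conjugate_braid_cong)
next
  case 2
  have "m sp s = enat k" using 2 k m_sym s sp by simp
  then have "wordelt (alt sp s k) \<approx> wordelt (alt s sp k)" using s sp by (intro hecke_braid_cong) auto
  moreover have "phi_gen sp sm y (Some s) \<approx> gen_inv L sm * gen s * gen sm"
    using gen_conj_sm[OF s(1) 2(1)] by simp
  ultimately show "prod_list (map (phi_gen sp sm y) (alt None (Some s) k))
      \<approx> prod_list (map (phi_gen sp sm y) (alt (Some s) None k))"
    using gen_inv_cong(2,1)[OF sm] phi_gen_None_conj_sm by (intro conjugate_braid_cong)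
qed (use k in simp)

text \<open>The image is conjugate to T_-, whose quadratic relation has the right parameter by
  \<open>L_eq\<close>.\<close>

lemma phi_quadratic_None:
  "(phi_gen sp sm y None - scal (vpow (L sp))) * (phi_gen sp sm y None + scal (vpow (- L sp)))
    \<in> ideal_gen (hecke_rels S m L)"
proof -
  define P Q \<xi> where "P = gen sp" and "Q = gen sm" and "\<xi> = vpow (L sp) - vpow (- L sp)"
  note P = sp_y[folded P_def] y_sp[folded P_def]
  have Q: "Q * Q \<approx> scal \<xi> * Q + 1"
    using hecke_quadratic_cong[OF sm, of m L] unfolding Q_def \<xi>_def L_eq .
  have "(P * Q * y) * (P * Q * y) = (P * Q) * (y * P) * (Q * y)" by (simp only: mult.assoc)
  also have "\<dots> \<approx> (P * Q) * 1 * (Q * y)"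
    by (rule ideal_cong_rmult[OF ideal_cong_lmult[OF P(2)]])
  also have "(P * Q) * 1 * (Q * y) = P * (Q * Q) * y" by (simp add: mult.assoc)
  also have "\<dots> \<approx> P * (scal \<xi> * Q + 1) * y"
    by (rule ideal_cong_rmult[OF ideal_cong_lmult[OF Q]])
  also have "P * (scal \<xi> * Q + 1) * y = scal \<xi> * (P * Q * y) + P * y"
    by (simp add: distrib_left distrib_right mult.assoc scal_commute[of \<xi>])
  also have "\<dots> \<approx> scal \<xi> * (P * Q * y) + 1"
    by (rule ideal_cong_add[OF ideal_cong_refl P(1)])
  finally show ?thesis
    unfolding hecke_quadratic ideal_cong_def by (simp add: P_def Q_def \<xi>_def)
qed

lemma phi_hecke_ideal:
  assumes "x \<in> hecke_ideal (contract_set S sp sm) (contract_matrix m sp sm) (contract_weight L sp)"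
  shows "phi x \<in> ideal_gen (hecke_rels S m L)"
  using assms unfolding hecke_ideal_def
proof (rule free_hom_ideal_gen)
  let ?S = "contract_set S sp sm" and ?n = "contract_matrix m sp sm" and ?L = "contract_weight L sp"
  fix r assume "r \<in> hecke_rels ?S ?n ?L"
  then consider (quad) i where "i \<in> ?S" "r = (gen i - scal (vpow (?L i))) * (gen i + scal (vpow (- ?L i)))"
    | (braid) i j k where "i \<in> ?S" "j \<in> ?S" "i \<noteq> j" "?n i j = enat k" "r = wordelt (alt i j k) - wordelt (alt j i k)"
    unfolding hecke_rels_def by blast
  then show "phi r \<in> ideal_gen (hecke_rels S m L)"
  proof cases
    case quad
    have phi_r: "phi r = (phi_gen sp sm y i - scal (vpow (?L i))) * (phi_gen sp sm y i + scal (vpow (- ?L i)))"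
      by (simp only: quad free_hom_mult free_hom_diff free_hom_add free_hom_gen free_hom_scal)
    show ?thesis
    proof (cases i)
      case None
      then show ?thesis using phi_quadratic_None phi_r by simp
    next
      case (Some s)
      then have "s \<in> S" using quad(1) by (simp add: in_contract_set)
      then have "(gen s - scal (vpow (L s))) * (gen s + scal (vpow (- L s))) \<in> hecke_rels S m L"
        unfolding hecke_rels_def by blast
      then show ?thesis using phi_r Some ideal_gen.base by simp
    qed
  next
    case braid
    have "phi (wordelt (alt i j k)) \<approx> phi (wordelt (alt j i k))"
    proof (cases i; cases j)
      fix s t assume ij: "i = Some s" "j = Some t"
      have map: "prod_list (map (phi_gen sp sm y) (alt (Some s) (Some t) k)) = wordelt (alt s t k)" for s t k
        by (induction k arbitrary: s t) (simp_all add: wordelt_Cons)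
      show ?thesis using braid ij unfolding free_hom_wordelt ij map
        by (intro hecke_braid_cong) (simp_all add: in_contract_set)
    next
      fix s assume ij: "i = None" "j = Some s"
      show ?thesis using phi_braid_None[of s k] braid(2,4) unfolding ij in_contract_set by blast
    next
      fix s assume ij: "i = Some s" "j = None"
      have "contract_matrix m sp sm None (Some s) = enat k" using braid(4) ij by simp
      then show ?thesis using ideal_cong_sym[OF phi_braid_None[of s k]] braid(1) unfolding ij in_contract_set by blast
    qed (use braid in simp)
    then show ?thesis unfolding braid(5) free_hom_diff by (simp add: ideal_cong_def)
  qed
qed

section \<open>The image at v = 1 and the descent\<close>

lemma rep_cong:
  assumes "x \<approx> z" "w \<in> E.elements"
  shows "rep (E.T L) x h w = rep (E.T L) z h w"
proof -
  have "rep (E.T L) (x - z) h w = 0"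
    using assms weight_eq_if_odd[OF weight]
    by (intro E.rep_T_hecke_ideal) (auto simp: ideal_cong_def hecke_ideal_def)
  then show ?thesis by (simp add: rep_diff)
qed

lemma contract_refl_elements:
  assumes "w \<in> E.elements" "i \<in> contract_set S sp sm"
  shows "w \<circ> E'.refl i \<in> E.elements"
proof (cases i)
  case None
  show ?thesis
    unfolding None contract_refl_None o_assoc using assms sp sm by (intro E.elements_refl)
next
  case (Some s)
  then show ?thesis
    using E.elements_refl[OF assms(1)] assms(2) by (simp add: contract_refl_Some in_contract_set)
qed

text \<open>At v = 1 both T_s and T_s^{-1} act as translation by the reflection of s, so the image
  of T'_{s_0} translates by s_+ s_- s_+.\<close>

lemma eval1_rep_phi_gen:
  assumes "i \<in> contract_set S sp sm" "w \<in> E.elements"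
  shows "eval1 (rep (E.T L) (phi_gen sp sm y i) h w) = eval1 (h (w \<circ> E'.refl i))"
proof (cases i)
  case None
  define g where "g = rep (E.T L) (gen_inv L sp) h"
  have g: "eval1 (g w) = eval1 (h (w \<circ> E.refl sp))" for w
  proof -
    have "gen_inv L sp = gen sp - scal (vpow (L sp) - vpow (- L sp)) * wordelt []"
      by (simp add: gen_inv_def)
    then have "g w = E.T L sp h w - (vpow (L sp) - vpow (- L sp)) * h w"
      unfolding g_def by (simp only: rep_diff rep_gen rep_term foldr.simps id_apply)
    then show ?thesis using E.eval1_T[OF sp] by (simp add: eval1_diff eval1_mult)
  qed
  \<comment> \<open>As \<open>y\<close> is an arbitrary representative of the inverse, it is
    exchanged for the explicit one, whose operator is known.\<close>
  have "y \<approx> gen_inv L sp"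
    using y_sp gen_inv_cong(1)[OF sp] by (rule inverse_unique_cong)
  then have "phi_gen sp sm y None \<approx> gen sp * gen sm * gen_inv L sp"
    unfolding phi_gen.simps by (rule ideal_cong_lmult)
  then have "rep (E.T L) (phi_gen sp sm y None) h w = rep (E.T L) (gen sp * gen sm * gen_inv L sp) h w"
    by (rule rep_cong[OF _ assms(2)])
  also have "\<dots> = E.T L sp (rep (E.T L) (gen sm) g) w"
    unfolding g_def by (simp only: E.rep_T_mult rep_gen)
  also have "rep (E.T L) (gen sm) g = E.T L sm g" by (rule ext) (rule rep_gen)
  finally show ?thesis
    unfolding None contract_refl_None by (simp add: E.eval1_T sp sm g comp_assoc)
next
  case (Some s)
  then have "s \<in> S" using assms(1) by (simp add: in_contract_set)
  then show ?thesis using Some by (simp add: rep_gen E.eval1_T contract_refl_Some)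
qed

text \<open>The operators multiply \<open>w\<close> on the right by the letters in reading order,
  whereas \<open>act\<close> lets the first letter act first; hence \<open>rev\<close>.\<close>

lemma eval1_rep_phi:
  assumes "u \<in> lists (contract_set S sp sm)" "w \<in> E.elements"
  shows "eval1 (rep (E.T L) (phi (wordelt u)) h w) = eval1 (h (w \<circ> E'.act (rev u)))"
  using assms
proof (induction u arbitrary: w)
  case Nil
  then show ?case using free_hom_wordelt[of "phi_gen sp sm y" "[]"] by (simp add: rep_1)
next
  case (Cons i u)
  note i = Cons.hyps(1)
  have "phi (wordelt (i # u)) = phi_gen sp sm y i * phi (wordelt u)"
    by (simp add: free_hom_wordelt)
  then have "eval1 (rep (E.T L) (phi (wordelt (i # u))) h w)
      = eval1 (rep (E.T L) (phi (wordelt u)) h (w \<circ> E'.refl i))"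
    by (simp only: E.rep_T_mult eval1_rep_phi_gen[OF i Cons.prems])
  moreover have "\<dots> = eval1 (h (w \<circ> E'.refl i \<circ> E'.act (rev u)))"
    using Cons.IH[OF contract_refl_elements[OF Cons.prems i]] .
  moreover have "E'.act (rev (i # u)) = E'.refl i \<circ> E'.act (rev u)"
    by (simp add: E'.act_append)
  ultimately show ?case by (simp only: o_assoc)
qed

theorem phi_injective:
  assumes "in_free (contract_set S sp sm) x" "phi x \<in> hecke_ideal S m L"
  shows "x \<in> hecke_ideal (contract_set S sp sm) (contract_matrix m sp sm) (contract_weight L sp)"
proof -
  let ?R = "hecke_rels (contract_set S sp sm) (contract_matrix m sp sm) (contract_weight L sp)"
  obtain a where a: "Poly_Mapping.keys a \<subseteq> E'.elements" and xa: "ideal_cong ?R x (E'.red_comb a)"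
    using E'.reduced_words_span[OF assms(1)] by blast
  let ?F = "Poly_Mapping.keys a"
  \<comment> \<open>The entry tests the image of T'_w at the identity against the indicator function
    of the inverse of w'. At v = 1 the operator evaluates that function at the inverse of w, so
    \<open>K\<close> becomes the identity matrix.\<close>
  define K where "K w w' = rep (E.T L) (phi (wordelt (E'.red_word w)))
      (\<lambda>z. if z = E'.act (rev (E'.red_word w')) then 1 else 0) id" for w w'
  have id: "id \<in> E.elements" using E.act_in_elements[of "[]"] by simp
  have inv: "E'.act (E'.red_word w) \<circ> E'.act (rev (E'.red_word w)) = id" if "w \<in> ?F" for w
  proof -
    have "rev (E'.red_word w) \<in> lists (contract_set S sp sm)"
      using that a E'.red_word(1) E'.reduced_in_lists by (auto simp: in_lists_conv_set)
    then show ?thesis using E'.act_rev by fastforce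
  qed
  have "phi (E'.red_comb a) \<approx> phi x"
    using phi_hecke_ideal[of "E'.red_comb a - x"] ideal_cong_sym[OF xa]
    by (simp add: ideal_cong_def hecke_ideal_def free_hom_diff)
  then have "phi (E'.red_comb a) \<approx> 0"
    using assms(2) ideal_cong_trans unfolding hecke_ideal_def
    by (metis diff_zero ideal_cong_def)
  then have zero: "rep (E.T L) (phi (E'.red_comb a)) h id = 0" for h
    using rep_cong[OF _ id] by (simp add: rep_0)
  have "Poly_Mapping.lookup a w = 0" if w: "w \<in> ?F" for w
  proof (rule zero_if_identity_at_1[where F = ?F and K = K and a = "Poly_Mapping.lookup a"])
    fix w w' assume ww: "w \<in> ?F" "w' \<in> ?F"
    have "E'.red_word w \<in> lists (contract_set S sp sm)"
      using ww a E'.red_word(1) E'.reduced_in_lists by blast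
    then have "eval1 (K w w') = (if E'.act (rev (E'.red_word w)) = E'.act (rev (E'.red_word w')) then 1 else 0)"
      unfolding K_def using eval1_rep_phi[OF _ id] by simp
    moreover have "w = w'" if eq: "E'.act (rev (E'.red_word w)) = E'.act (rev (E'.red_word w'))"
    proof -
      have "rev (E'.red_word w') \<in> lists (contract_set S sp sm)"
        using ww a E'.red_word(1) E'.reduced_in_lists by (auto simp: in_lists_conv_set)
      then have "E'.act (rev (E'.red_word w')) \<circ> E'.act (E'.red_word w') = id"
        using E'.act_rev[of "E'.red_word w'"] \<open>E'.red_word w \<in> _\<close> ww a E'.red_word(1) E'.reduced_in_lists by blast
      then have "E'.act (E'.red_word w)
          = E'.act (E'.red_word w) \<circ> (E'.act (rev (E'.red_word w)) \<circ> E'.act (E'.red_word w'))"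
        unfolding eq by simp
      also have "\<dots> = E'.act (E'.red_word w')" unfolding o_assoc inv[OF ww(1)] by simp
      finally have "E'.act (E'.red_word w) = E'.act (E'.red_word w')" .
      moreover have "w \<in> E'.elements" "w' \<in> E'.elements" using ww a by auto
      ultimately show ?thesis using E'.red_word(2) by metis
    qed
    ultimately show "eval1 (K w w') = (if w = w' then 1 else 0)" by auto
  next
    fix w' assume "w' \<in> ?F"
    have "(\<Sum>w\<in>?F. Poly_Mapping.lookup a w * rep (E.T L) (phi (wordelt (E'.red_word w))) h id)
        = rep (E.T L) (phi (E'.red_comb a)) h id" for h
    proof -
      have "rep (E.T L) (scal c * z) h id = c * rep (E.T L) z h id" for c z
      proof -
        have "rep (E.T L) (scal c * z) h id = rep (E.T L) (scal c * wordelt []) (rep (E.T L) z h) id"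
          by (simp only: E.rep_T_mult[symmetric] wordelt_Nil mult_1_right)
        then show ?thesis by (simp only: rep_term foldr.simps id_apply)
      qed
      then show ?thesis
        unfolding E'.red_comb_def free_hom_sum rep_sum by (simp add: free_hom_mult free_hom_scal)
    qed
    then show "(\<Sum>w\<in>?F. Poly_Mapping.lookup a w * K w w') = 0"
      unfolding K_def using zero by simp
  qed (use w in simp_all)
  then have "E'.red_comb a = 0"
    unfolding E'.red_comb_def by simp
  then show ?thesis using xa by (simp add: ideal_cong_def hecke_ideal_def)
qed

end

theorem mainTheorem6:
  fixes S :: "'s set" and m :: "'s \<Rightarrow> 's \<Rightarrow> enat" and L :: "'s \<Rightarrow> int"
    and sp sm :: 's and y :: "'s falg"
  assumes "coxeter_matrix S m"
    and "weight_function S m L"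
    and "sp \<in> S" and "sm \<in> S" and "sp \<noteq> sm" and "m sp sm = 3"
    and "in_free S y"
    and "gen sp * y - 1 \<in> hecke_ideal S m L"
    and "y * gen sp - 1 \<in> hecke_ideal S m L"
  shows "\<forall>x. in_free (contract_set S sp sm) x \<longrightarrow>
           free_hom (phi_gen sp sm y) x \<in> hecke_ideal S m L \<longrightarrow>
           x \<in> hecke_ideal (contract_set S sp sm) (contract_matrix m sp sm)
                 (contract_weight L sp)"
proof -
  interpret weighted_edge S m sp sm L y
    using assms by unfold_locales (simp_all add: ideal_cong_def hecke_ideal_def)
  show ?thesis using phi_injective by blast
qed

end
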